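(* Let $\mathcal{H}_A,\mathcal{H}_{B_1},\mathcal{H}_{B_2},\mathcal{H}_C$ be finite-dimensional Hilbert spaces and let the initial state be a product $\tau=\tau_{AB_1}\otimes\tau_{B_2C}$, where $\tau_{AB_1}$ is a density operator on $\mathcal{H}_A\otimes\mathcal{H}_{B_1}$ and $\tau_{B_2C}$ a density operator on $\mathcal{H}_{B_2}\otimes\mathcal{H}_C$. Let $\mathscr{B}=(B^b_{B_1B_2})_{b=0}^{3}$ be a four-outcome POVM on $\mathcal{H}_{B_1}\otimes\mathcal{H}_{B_2}$. Let $A_0,A_1$ be Hermitian operators on $\mathcal{H}_A$ and $C_0,C_1$ Hermitian operators on $\mathcal{H}_C$ with $A_x^2=\mathbb{1}$, $C_z^2=\mathbb{1}$. Suppose that for every $b\in\{0,1,2,3\}$ we have $p_b>0$ and $\operatorname{tr}(W_b\,\tau^b_{AC})=2\sqrt2$. Then there exist completely positive unital maps $\Lambda_{B_1}:\mathcal{L}(\mathcal{H}_{B_1})\to\mathcal{L}(\mathbb{C}^2)$ and $\Lambda_{B_2}:\mathcal{L}(\mathcal{H}_{B_2})\to\mathcal{L}(\mathbb{C}^2)$ such that $$(\Lambda_{B_1}\otimes\Lambda_{B_2})(B^b_{B_1B_2})=\Phi^b\qquad\text{for all } b\in\{0,1,2,3\}.$$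
   Context: Bell states on $\mathbb{C}^2\otimes\mathbb{C}^2$: $|\Phi^0\rangle=(|00\rangle+|11\rangle)/\sqrt2$, $|\Phi^1\rangle=(|00\rangle-|11\rangle)/\sqrt2$, $|\Phi^2\rangle=(|01\rangle+|10\rangle)/\sqrt2$, $|\Phi^3\rangle=(|01\rangle-|10\rangle)/\sqrt2$, and $\Phi^b:=|\Phi^b\rangle\langle\Phi^b|$; the Bell-state measurement is $\Phi=(\Phi^b)_{b=0}^3$. For Bob's outcome $b$: $p_b:=\operatorname{tr}[(\mathbb{1}_A\otimes B^b_{B_1B_2}\otimes\mathbb{1}_C)\tau]$ and (when $p_b>0$) $\tau^b_{AC}:=\frac1{p_b}\operatorname{tr}_{B_1B_2}[(\mathbb{1}_A\otimes B^b_{B_1B_2}\otimes\mathbb{1}_C)\tau]$. Bell operators on $\mathcal{H}_A\otimes\mathcal{H}_C$: $W_0:=A_0\otimes C_0+A_0\otimes C_1+A_1\otimes C_0-A_1\otimes C_1$, $W_1:=A_0\otimes C_0+A_0\otimes C_1-A_1\otimes C_0+A_1\otimes C_1$, $W_2:=-W_1$, $W_3:=-W_0$. A map $\Lambda$ is unital if $\Lambda(\mathbb{1})=\mathbb{1}$. *)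

theory Defs
  imports Complex_Main "Jordan_Normal_Form.Matrix"
begin

text \<open>Finite-dimensional Hilbert spaces are modelled as C^n; operators as n x n complex
matrices. Tensor products use the Kronecker product with the standard index convention:
the basis vector |i> (x) |j> of C^m (x) C^n has index i*n+j.\<close>

definition adj :: "complex mat \<Rightarrow> complex mat" where
  "adj M = mat (dim_col M) (dim_row M) (\<lambda>(i,j). cnj (M $$ (j,i)))"

definition mtrace :: "complex mat \<Rightarrow> complex" where
  "mtrace M = (\<Sum>i<dim_row M. M $$ (i,i))"

definition hermitian_op :: "nat \<Rightarrow> complex mat \<Rightarrow> bool" where
  "hermitian_op n M \<longleftrightarrow> M \<in> carrier_mat n n \<and> adj M = M"

definition psd :: "nat \<Rightarrow> complex mat \<Rightarrow> bool" where
  "psd n M \<longleftrightarrow> M \<in> carrier_mat n n \<and>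
     (\<forall>v \<in> carrier_vec n. Im (conjugate v \<bullet> (M *\<^sub>v v)) = 0 \<and> Re (conjugate v \<bullet> (M *\<^sub>v v)) \<ge> 0)"

definition density_op :: "nat \<Rightarrow> complex mat \<Rightarrow> bool" where
  "density_op n \<rho> \<longleftrightarrow> psd n \<rho> \<and> mtrace \<rho> = 1"

definition kron :: "complex mat \<Rightarrow> complex mat \<Rightarrow> complex mat" where
  "kron A B = mat (dim_row A * dim_row B) (dim_col A * dim_col B)
     (\<lambda>(i,j). A $$ (i div dim_row B, j div dim_col B) * B $$ (i mod dim_row B, j mod dim_col B))"

definition ptrace_mid :: "nat \<Rightarrow> nat \<Rightarrow> nat \<Rightarrow> complex mat \<Rightarrow> complex mat" where
  "ptrace_mid dA dM dC M = mat (dA * dC) (dA * dC)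
     (\<lambda>(r,s). \<Sum>m<dM. M $$ ((r div dC) * dM * dC + m * dC + r mod dC,
                              (s div dC) * dM * dC + m * dC + s mod dC))"

definition povm4 :: "nat \<Rightarrow> (nat \<Rightarrow> complex mat) \<Rightarrow> bool" where
  "povm4 n B \<longleftrightarrow> (\<forall>b<4. psd n (B b)) \<and> B 0 + B 1 + B 2 + B 3 = 1\<^sub>m n"

definition matunit :: "nat \<Rightarrow> nat \<Rightarrow> nat \<Rightarrow> complex mat" where
  "matunit n i j = mat n n (\<lambda>(a,b). if a = i \<and> b = j then 1 else 0)"

definition linear_op_map :: "nat \<Rightarrow> nat \<Rightarrow> (complex mat \<Rightarrow> complex mat) \<Rightarrow> bool" where
  "linear_op_map n m \<Lambda> \<longleftrightarrow>
     (\<forall>X \<in> carrier_mat n n. \<Lambda> X \<in> carrier_mat m m) \<and>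
     (\<forall>X \<in> carrier_mat n n. \<forall>Y \<in> carrier_mat n n. \<Lambda> (X + Y) = \<Lambda> X + \<Lambda> Y) \<and>
     (\<forall>X \<in> carrier_mat n n. \<forall>c. \<Lambda> (c \<cdot>\<^sub>m X) = c \<cdot>\<^sub>m \<Lambda> X)"

text \<open>The amplification id_k (x) Lambda, acting on L(C^k (x) C^n) blockwise.\<close>
definition ampl :: "nat \<Rightarrow> nat \<Rightarrow> nat \<Rightarrow> (complex mat \<Rightarrow> complex mat) \<Rightarrow> complex mat \<Rightarrow> complex mat" where
  "ampl k n m \<Lambda> X = mat (k * m) (k * m)
     (\<lambda>(r,s). \<Lambda> (mat n n (\<lambda>(a,b). X $$ ((r div m) * n + a, (s div m) * n + b))) $$ (r mod m, s mod m))"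

definition completely_positive :: "nat \<Rightarrow> nat \<Rightarrow> (complex mat \<Rightarrow> complex mat) \<Rightarrow> bool" where
  "completely_positive n m \<Lambda> \<longleftrightarrow> linear_op_map n m \<Lambda> \<and>
     (\<forall>k>0. \<forall>X. psd (k * n) X \<longrightarrow> psd (k * m) (ampl k n m \<Lambda> X))"

definition unital :: "nat \<Rightarrow> nat \<Rightarrow> (complex mat \<Rightarrow> complex mat) \<Rightarrow> bool" where
  "unital n m \<Lambda> \<longleftrightarrow> \<Lambda> (1\<^sub>m n) = 1\<^sub>m m"

text \<open>(Lambda1 (x) Lambda2)(X) for X in L(C^n1 (x) C^n2), defined by linear extension
from (Lambda1 (x) Lambda2)(E_ij (x) E_kl) = Lambda1(E_ij) (x) Lambda2(E_kl).\<close>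
definition tensor_map ::
  "nat \<Rightarrow> nat \<Rightarrow> nat \<Rightarrow> nat \<Rightarrow> (complex mat \<Rightarrow> complex mat) \<Rightarrow> (complex mat \<Rightarrow> complex mat) \<Rightarrow> complex mat \<Rightarrow> complex mat" where
  "tensor_map n1 n2 m1 m2 \<Lambda>1 \<Lambda>2 X = mat (m1 * m2) (m1 * m2) (\<lambda>(r,s).
     \<Sum>i<n1. \<Sum>j<n1. \<Sum>k<n2. \<Sum>l<n2.
        X $$ (i * n2 + k, j * n2 + l) *
        \<Lambda>1 (matunit n1 i j) $$ (r div m2, s div m2) *
        \<Lambda>2 (matunit n2 k l) $$ (r mod m2, s mod m2))"

text \<open>Bell states in C^2 (x) C^2, basis index of |xy> is 2x+y.\<close>
definition bell_vec :: "nat \<Rightarrow> complex vec" where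
  "bell_vec b = (1 / complex_of_real (sqrt 2)) \<cdot>\<^sub>v
     (if b = 0 then vec_of_list [1, 0, 0, 1]
      else if b = 1 then vec_of_list [1, 0, 0, -1]
      else if b = 2 then vec_of_list [0, 1, 1, 0]
      else vec_of_list [0, 1, -1, 0])"

definition bell_proj :: "nat \<Rightarrow> complex mat" where
  "bell_proj b = mat 4 4 (\<lambda>(i,j). bell_vec b $ i * cnj (bell_vec b $ j))"

definition bell_op :: "complex mat \<Rightarrow> complex mat \<Rightarrow> complex mat \<Rightarrow> complex mat \<Rightarrow> nat \<Rightarrow> complex mat" where
  "bell_op A0 A1 C0 C1 b =
    (let W0 = kron A0 C0 + kron A0 C1 + kron A1 C0 - kron A1 C1;
         W1 = kron A0 C0 + kron A0 C1 - kron A1 C0 + kron A1 C1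
     in if b = 0 then W0 else if b = 1 then W1 else if b = 2 then - W1 else - W0)"

definition outcome_prob :: "nat \<Rightarrow> nat \<Rightarrow> complex mat \<Rightarrow> complex mat \<Rightarrow> complex" where
  "outcome_prob dA dC Bb \<tau> = mtrace (kron (kron (1\<^sub>m dA) Bb) (1\<^sub>m dC) * \<tau>)"

definition post_state :: "nat \<Rightarrow> nat \<Rightarrow> nat \<Rightarrow> complex mat \<Rightarrow> complex mat \<Rightarrow> complex mat" where
  "post_state dA dM dC Bb \<tau> = (1 / outcome_prob dA dC Bb \<tau>) \<cdot>\<^sub>m
     ptrace_mid dA dM dC (kron (kron (1\<^sub>m dA) Bb) (1\<^sub>m dC) * \<tau>)"

end

theory Submission
  imports Defs
begin

text \<open>Write \<open>\<tau>\<^sub>A\<^sub>B\<close>, \<open>\<tau>\<^sub>B\<^sub>C\<close> and \<open>B b\<close> as sums of rank-one operators. Bob's outcome \<open>b\<close> then leaves Alice and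
  Charlie with a mixture of vectors \<open>\<phi> = R1 * cnj \<beta> * R2\<close>, read as \<open>dA \<times> dC\<close> matrices, on which Alice acts
  from the left and Charlie, transposed, from the right. With \<open>S = (C0 + C1)\<^sup>T / \<surd>2\<close> and
  \<open>D = (C0 - C1)\<^sup>T / \<surd>2\<close>, saturation of the Tsirelson bound is equivalent to \<open>A0 \<phi> = \<plusminus> \<phi> S\<close> and
  \<open>A1 \<phi> = \<plusminus> \<phi> D\<close> for every \<open>\<phi>\<close>, with the signs of the stabilizers of the \<open>b\<close>-th Bell state. Since \<open>S\<close> and \<open>D\<close>
  anticommute, the four matrices \<open>F i * \<phi> * G k\<close> with \<open>F = (1 + A0, (1 + A0) A1)\<close> and
  \<open>G = (1 + S, D (1 + S))\<close> are the coefficients of that Bell state times one matrix. Let \<open>\<Lambda>1\<close> have the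
  rows of the \<open>F i * R1\<close> as Kraus operators, and \<open>\<Lambda>2\<close> the columns of the \<open>R2 * G k\<close>; then
  \<open>(\<Lambda>1 \<otimes> \<Lambda>2)(B b) = c b * \<Phi> b\<close> with \<open>c b > 0\<close>. Summing over \<open>b\<close>, \<open>\<Lambda>1 1 \<otimes> \<Lambda>2 1\<close> is a mixture of Bell states
  with positive weights, which forces both factors to be multiples of the identity and the weights to be
  equal; so rescaling \<open>\<Lambda>1\<close> and \<open>\<Lambda>2\<close> makes them unital and all \<open>c b = 1\<close>.\<close>

section \<open>Gram decomposition of positive matrices\<close>

text \<open>Stated over functions instead of \<open>complex vec\<close>, so that an induction on the
  size can shrink \<open>M\<close> and change single coordinates without dimension
  conditions.\<close>

definition qform :: "nat \<Rightarrow> (nat \<Rightarrow> nat \<Rightarrow> complex) \<Rightarrow> (nat \<Rightarrow> complex) \<Rightarrow> complex" where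
  "qform n M v = (\<Sum>i<n. \<Sum>j<n. cnj (v i) * M i j * v j)"

lemma quadratic_form_eq_qform:
  assumes "M \<in> carrier_mat n n" "v \<in> carrier_vec n"
  shows "conjugate v \<bullet> (M *\<^sub>v v) = qform n (\<lambda>i j. M $$ (i,j)) (\<lambda>i. v $ i)"
  using assms
  by (auto simp: qform_def scalar_prod_def sum_distrib_left mult.assoc atLeast0LessThan intro!: sum.cong)

lemma qform_cong: "(\<And>i. i < n \<Longrightarrow> v i = w i) \<Longrightarrow> qform n M v = qform n M w"
  by (simp add: qform_def)

text \<open>The order on \<open>complex\<close> packs "real and nonnegative" into
  \<open>0 \<le>\<close>. Values of \<open>v\<close> from \<open>n\<close> on do not enter, so every
  function may serve as a test vector.\<close>

lemma psd_iff_qform: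
  "psd n M \<longleftrightarrow> M \<in> carrier_mat n n \<and> (\<forall>v. 0 \<le> qform n (\<lambda>i j. M $$ (i,j)) v)"
proof -
  have "(\<forall>v \<in> carrier_vec n. 0 \<le> conjugate v \<bullet> (M *\<^sub>v v)) \<longleftrightarrow>
      (\<forall>v. 0 \<le> qform n (\<lambda>i j. M $$ (i,j)) v)" if "M \<in> carrier_mat n n"
  proof (intro iffI allI ballI)
    fix v assume "\<forall>v \<in> carrier_vec n. 0 \<le> conjugate v \<bullet> (M *\<^sub>v v)"
    then have "0 \<le> qform n (\<lambda>i j. M $$ (i,j)) (\<lambda>i. vec n v $ i)"
      using that by (metis quadratic_form_eq_qform vec_carrier)
    also have "\<dots> = qform n (\<lambda>i j. M $$ (i,j)) v"
      by (rule qform_cong) simp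
    finally show "0 \<le> qform n (\<lambda>i j. M $$ (i,j)) v" .
  qed (use that in \<open>simp add: quadratic_form_eq_qform\<close>)
  then show ?thesis
    by (auto simp: psd_def less_eq_complex_def)
qed

lemma qform_Suc:
  "qform (Suc n) M v = qform n M v + cnj (v n) * (\<Sum>j<n. M n j * v j)
     + (\<Sum>i<n. cnj (v i) * M i n) * v n + cnj (v n) * M n n * v n"
  by (simp add: qform_def sum.distrib sum_distrib_left sum_distrib_right algebra_simps)

lemma qform_single: "k < n \<Longrightarrow> qform n M (\<lambda>i. if i = k then z else 0) = cnj z * M k k * z"
  by (simp add: qform_def if_distrib[of cnj] if_distrib[of "\<lambda>x. x * _"] if_distrib[of "\<lambda>x. _ * x"] cong: if_cong)

lemma sum_delta_pair:
  fixes c :: "'a :: comm_monoid_add" and k l n m :: nat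
  assumes "k < n" "l < m"
  shows "(\<Sum>i<n. \<Sum>j<m. if i = k \<and> j = l then c else 0) = c"
proof -
  have "(\<Sum>j<m. if i = k \<and> j = l then c else 0) = (if i = k then c else 0)" for i
    using assms by (cases "i = k") auto
  then show ?thesis using assms by simp
qed

lemma qform_pair:
  assumes "k < n" "l < n" "k \<noteq> l"
  shows "qform n M (\<lambda>i. if i = k then x else if i = l then y else 0) =
    cnj x * M k k * x + cnj x * M k l * y + cnj y * M l k * x + cnj y * M l l * y"
proof -
  have "qform n M (\<lambda>i. if i = k then x else if i = l then y else 0) =
     (\<Sum>i<n. \<Sum>j<n. (if i = k \<and> j = k then cnj x * M k k * x else 0)
       + (if i = k \<and> j = l then cnj x * M k l * y else 0)
       + (if i = l \<and> j = k then cnj y * M l k * x else 0)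
       + (if i = l \<and> j = l then cnj y * M l l * y else 0))"
    unfolding qform_def using assms by (intro sum.cong refl) auto
  also have "\<dots> = cnj x * M k k * x + cnj x * M k l * y + cnj y * M l k * x + cnj y * M l l * y"
    using assms by (simp only: sum.distrib sum_delta_pair)
  finally show ?thesis .
qed

lemma qform_nonneg_diag:
  assumes "\<And>v. 0 \<le> qform n M v" "k < n" shows "0 \<le> M k k"
  using assms(1)[of "\<lambda>i. if i = k then 1 else 0"] assms(2) by (simp add: qform_single)

text \<open>Polarization: the diagonal is real, and so are the values of the form at e_k + e_l and
  e_k + i e_l. They compare the imaginary and the real parts of \<open>M k l\<close> and
  \<open>M l k\<close>.\<close>

lemma qform_nonneg_hermitian:
  assumes nn: "\<And>v. 0 \<le> qform n M v" and "k < n" "l < n"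
  shows "M l k = cnj (M k l)"
proof (cases "k = l")
  case True
  then show ?thesis using qform_nonneg_diag[of n M, OF nn] assms by (simp add: less_eq_complex_def complex_eq_iff)
next
  case False
  have d: "Im (M k k) = 0" "Im (M l l) = 0"
    using qform_nonneg_diag[of n M, OF nn] assms by (auto simp: less_eq_complex_def)
  have "0 \<le> M k k + M k l + M l k + M l l"
    using nn[of "\<lambda>i. if i = k then 1 else if i = l then 1 else 0"] assms False by (simp add: qform_pair)
  moreover have "0 \<le> M k k + M k l * \<i> - \<i> * M l k + M l l"
    using nn[of "\<lambda>i. if i = k then 1 else if i = l then \<i> else 0"] assms False
    by (simp add: qform_pair mult.commute[of "\<i> * _" "\<i>"] mult.assoc[symmetric])
  ultimately show ?thesis using d by (simp add: less_eq_complex_def complex_eq_iff)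
qed

text \<open>At e_k - x \<open>cnj (M k l)\<close> e_l the form is affine in the real number x with
  slope -2 |\<open>M k l\<close>|^2, so it stays nonnegative only if the slope is 0.\<close>

lemma qform_nonneg_null:
  assumes nn: "\<And>v. 0 \<le> qform n M v" and kl: "k < n" "l < n" and "M l l = 0"
  shows "M k l = 0"
proof (cases "k = l")
  case False
  have h: "M l k = cnj (M k l)" using nn kl by (rule qform_nonneg_hermitian)
  define a where "a = Re (M k k)"
  define r where "r = (cmod (M k l))\<^sup>2"
  have a: "M k k = of_real a" using qform_nonneg_diag[of n M, OF nn] kl
    by (auto simp: a_def less_eq_complex_def complex_eq_iff)
  have "a - 2 * x * r \<ge> 0" for x :: real
  proof -
    have "0 \<le> M k k + M k l * (- of_real x * cnj (M k l)) + (- of_real x * M k l) * M l k"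
      using nn[of "\<lambda>i. if i = k then 1 else if i = l then - of_real x * cnj (M k l) else 0"] kl False assms(4)
      by (simp add: qform_pair)
    also have "\<dots> = of_real (a - 2 * x * r)"
      by (simp add: a h r_def complex_norm_square del: of_real_power flip: of_real_power)
    finally show ?thesis by (simp add: less_eq_complex_def)
  qed
  \<comment> \<open>For nonzero \<open>r\<close> this value of \<open>x\<close> would turn the
    left-hand side into -1.\<close>
  from this[of "(a + 1) / (2 * r)"] have "r = 0" by (cases "r = 0") auto
  then show ?thesis by (simp add: r_def)
qed (use assms in simp)

text \<open>Cholesky decomposition by induction: splitting off the last index leaves a Schur
  complement, which is again positive.\<close>

lemma qform_nonneg_gram:
  assumes "\<And>v. 0 \<le> qform n M v"
  shows "\<exists>r. \<forall>i<n. \<forall>j<n. M i j = (\<Sum>l<n. r l i * cnj (r l j))"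
  using assms
proof (induction n arbitrary: M)
  case (Suc n)
  note nn = Suc.prems
  have herm: "M l k = cnj (M k l)" if "k \<le> n" "l \<le> n" for k l
    by (rule qform_nonneg_hermitian[of "Suc n" M, OF nn]) (use that in auto)
  have herm_n: "M n k = cnj (M k n)" if "k < n" for k
    by (rule herm) (use that in auto)
  obtain m where m: "M n n = of_real m" "m \<ge> 0"
    using qform_nonneg_diag[of "Suc n" M n, OF nn] 
    by (intro that[of "Re (M n n)"]) (auto simp: less_eq_complex_def complex_eq_iff)
  have null: "M k n = 0" if "m = 0" "k \<le> n" for k
    using qform_nonneg_null[of "Suc n" M k n, OF nn] that m by auto
  \<comment> \<open>The Schur complement of the last diagonal entry. For \<open>m = 0\<close> the
    quotient is 0 by convention, which loses nothing since the last column vanishes by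
    \<open>null\<close>.\<close>
  define N where "N i j = M i j - M i n * cnj (M j n) / of_real m" for i j
  have "0 \<le> qform n N v" for v
  proof -
    define s where "s = (\<Sum>j<n. M n j * v j)"
    have cs: "(\<Sum>i<n. cnj (v i) * M i n) = cnj s"
      by (auto simp: s_def herm_n mult.commute intro!: sum.cong)
    \<comment> \<open>The last coordinate is chosen to minimize the form, that is, by completing the
      square.\<close>
    have "0 \<le> qform (Suc n) M (v(n := - s / of_real m))" by (rule nn)
    also have "\<dots> = qform n M v - s * cnj s / of_real m"
    proof -
      have 1: "qform n M (v(n := z)) = qform n M v" for z
        by (rule qform_cong) auto
      show ?thesis
        using cs by (simp add: qform_Suc 1 s_def[symmetric] m)
    qed
    also have "\<dots> = qform n N v"
    proof -
      have "s * cnj s = (\<Sum>i<n. \<Sum>j<n. cnj (v i) * (M i n * cnj (M j n)) * v j)"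
        unfolding cs[symmetric] unfolding s_def sum_product sum_distrib_left sum_distrib_right
        by (auto intro!: sum.cong simp: herm_n)
      then show ?thesis
        by (simp add: qform_def N_def algebra_simps sum_subtractf sum_divide_distrib diff_divide_distrib)
    qed
    finally show ?thesis .
  qed
  from Suc.IH[OF this] obtain r where r: "\<And>i j. i < n \<Longrightarrow> j < n \<Longrightarrow> N i j = (\<Sum>l<n. r l i * cnj (r l j))"
    by blast
  \<comment> \<open>The new vector is the last column divided by \<open>sqrt m\<close>; the earlier
    vectors are extended by 0.\<close>
  define r' where "r' l i = (if l = n then M i n / of_real (sqrt m) else if i = n then 0 else r l i)" for l i
  have "M i j = (\<Sum>l<Suc n. r' l i * cnj (r' l j))" if "i \<le> n" "j \<le> n" for i j
  proof -
    have sq: "complex_of_real (sqrt m) * complex_of_real (sqrt m) = of_real m"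
      using m by (simp flip: of_real_mult)
    have "(\<Sum>l<Suc n. r' l i * cnj (r' l j)) = (\<Sum>l<n. r' l i * cnj (r' l j)) + M i n * cnj (M j n) / of_real m"
      by (simp add: r'_def sq)
    also have "(\<Sum>l<n. r' l i * cnj (r' l j)) = N i j"
    proof (cases "i < n \<and> j < n")
      case True
      then show ?thesis by (simp add: r r'_def)
    next
      case False
      then have "N i j = 0"
        using that m null by (cases "m = 0") (auto simp: N_def herm_n le_less)
      with False that show ?thesis by (auto simp: r'_def intro!: sum.neutral)
    qed
    finally show ?thesis by (simp add: N_def)
  qed
  then show ?case by (metis less_Suc_eq_le)
qed simp

lemma psd_gram:
  assumes "psd n M"
  obtains r where "\<And>i j. i < n \<Longrightarrow> j < n \<Longrightarrow> M $$ (i,j) = (\<Sum>l<n. r l i * cnj (r l j))"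
  using qform_nonneg_gram[of n "\<lambda>i j. M $$ (i,j)"] assms by (auto simp: psd_iff_qform)

section \<open>Kraus maps and their tensor products\<close>

lemma mult_add_less: "i < m \<Longrightarrow> j < n \<Longrightarrow> i * n + j < m * (n::nat)"
proof -
  assume "i < m" "j < n"
  then have "i * n + j < Suc i * n" by simp
  also have "\<dots> \<le> m * n" using \<open>i < m\<close> by (intro mult_right_mono) auto
  finally show ?thesis .
qed

lemma less_mult_div_mod:
  assumes "r < m * (n::nat)"
  shows "r div n < m" "r mod n < n"
proof -
  from assms have "n > 0" by (cases n) auto
  then show "r mod n < n" by simp
qed (use assms in \<open>rule less_mult_imp_div_less\<close>)

lemma sum_lessThan_mult:
  fixes f :: "nat \<Rightarrow> 'a :: comm_monoid_add"
  shows "(\<Sum>r<m * n. f r) = (\<Sum>i<m. \<Sum>j<n. f (i * n + j))"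
proof -
  have "(\<Sum>i<m. \<Sum>j<n. f (i * n + j)) = (\<Sum>(i,j)\<in>{..<m} \<times> {..<n}. f (i * n + j))"
    by (rule sum.cartesian_product)
  also have "\<dots> = (\<Sum>r<m * n. f r)"
    by (rule sum.reindex_bij_witness[of _ "\<lambda>r. (r div n, r mod n)" "\<lambda>(i,j). i * n + j"])
      (auto simp: mult_add_less less_mult_div_mod)
  finally show ?thesis ..
qed

lemma kron_carrier [simp]:
  "A \<in> carrier_mat m n \<Longrightarrow> B \<in> carrier_mat p q \<Longrightarrow> kron A B \<in> carrier_mat (m * p) (n * q)"
  by (auto simp: kron_def)

lemma index_kron:
  assumes "A \<in> carrier_mat m n" "B \<in> carrier_mat p q" "i < m" "k < p" "j < n" "l < q"
  shows "kron A B $$ (i * p + k, j * q + l) = A $$ (i,j) * B $$ (k,l)"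
  using assms by (auto simp: kron_def mult_add_less)

text \<open>The map taking X to the sum of V^* X V over the family, with each n x m matrix V given
  by its entries. The adjoint stands on the left because effects, not states, are mapped.\<close>

definition kraus ::
  "nat \<Rightarrow> nat \<Rightarrow> 'k set \<Rightarrow> ('k \<Rightarrow> nat \<Rightarrow> nat \<Rightarrow> complex) \<Rightarrow> complex mat \<Rightarrow> complex mat" where
  "kraus n m I V X = mat m m (\<lambda>(i,j). \<Sum>\<kappa>\<in>I. \<Sum>x<n. \<Sum>y<n. cnj (V \<kappa> x i) * X $$ (x,y) * V \<kappa> y j)"

lemma kraus_carrier [simp]: "kraus n m I V X \<in> carrier_mat m m"
  by (simp add: kraus_def)

lemma linear_op_map_kraus: "linear_op_map n m (kraus n m I V)"
  unfolding linear_op_map_def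
proof (intro conjI ballI allI)
  fix X Y :: "complex mat" and c :: complex
  assume "X \<in> carrier_mat n n"
  then show "kraus n m I V (c \<cdot>\<^sub>m X) = c \<cdot>\<^sub>m kraus n m I V X"
    by (intro eq_matI) (auto simp: kraus_def sum_distrib_left ac_simps intro!: sum.cong)
  assume "Y \<in> carrier_mat n n"
  with \<open>X \<in> _\<close> show "kraus n m I V (X + Y) = kraus n m I V X + kraus n m I V Y"
    by (intro eq_matI) (auto simp: kraus_def algebra_simps sum.distrib[symmetric] intro!: sum.cong)
qed simp

text \<open>The amplified map tested on \<open>v\<close> is \<open>X\<close> tested on the vectors
  (1 \<otimes> V) v, so complete positivity follows at once.\<close>

lemma qform_ampl_kraus:
  assumes "X \<in> carrier_mat (k * n) (k * n)"
  shows "qform (k * m) (\<lambda>r s. ampl k n m (kraus n m I V) X $$ (r,s)) v =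
    (\<Sum>\<kappa>\<in>I. qform (k * n) (\<lambda>r s. X $$ (r,s)) (\<lambda>r. \<Sum>i<m. V \<kappa> (r mod n) i * v (r div n * m + i)))"
proof -
  have entry: "ampl k n m (kraus n m I V) X $$ (p * m + i, q * m + j) =
     (\<Sum>\<kappa>\<in>I. \<Sum>x<n. \<Sum>y<n. cnj (V \<kappa> x i) * X $$ (p * n + x, q * n + y) * V \<kappa> y j)"
    if "p < k" "q < k" "i < m" "j < m" for p q i j
    using that by (simp add: ampl_def kraus_def mult_add_less)
  have "qform (k * m) (\<lambda>r s. ampl k n m (kraus n m I V) X $$ (r,s)) v =
     (\<Sum>p<k. \<Sum>i<m. \<Sum>q<k. \<Sum>j<m. cnj (v (p * m + i)) *
      (\<Sum>\<kappa>\<in>I. \<Sum>x<n. \<Sum>y<n. cnj (V \<kappa> x i) * X $$ (p * n + x, q * n + y) * V \<kappa> y j) * v (q * m + j))"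
    unfolding qform_def sum_lessThan_mult by (intro sum.cong refl) (simp add: entry)
  \<comment> \<open>Once everything is distributed, both sides are a single sum over index tuples
    with the same terms; the bijection only permutes the components.\<close>
  also have "\<dots> = (\<Sum>\<kappa>\<in>I. \<Sum>p<k. \<Sum>x<n. \<Sum>q<k. \<Sum>y<n.
      (\<Sum>i<m. cnj (V \<kappa> x i) * cnj (v (p * m + i))) * X $$ (p * n + x, q * n + y) *
      (\<Sum>j<m. V \<kappa> y j * v (q * m + j)))"
    unfolding sum_distrib_left sum_distrib_right sum.cartesian_product
    by (rule sum.reindex_bij_witness[of _
        "\<lambda>(\<kappa>,p,x,q,y,j,i). (p,i,q,j,\<kappa>,x,y)" "\<lambda>(p,i,q,j,\<kappa>,x,y). (\<kappa>,p,x,q,y,j,i)"])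
      auto
  also have "\<dots> = (\<Sum>\<kappa>\<in>I. qform (k * n) (\<lambda>r s. X $$ (r,s)) (\<lambda>r. \<Sum>i<m. V \<kappa> (r mod n) i * v (r div n * m + i)))"
    unfolding qform_def sum_lessThan_mult by (intro sum.cong refl) simp
  finally show ?thesis .
qed

lemma completely_positive_kraus: "completely_positive n m (kraus n m I V)"
  unfolding completely_positive_def
proof (intro conjI linear_op_map_kraus allI impI)
  fix k X assume "psd (k * n) X"
  then show "psd (k * m) (ampl k n m (kraus n m I V) X)"
    by (auto simp: psd_iff_qform qform_ampl_kraus intro!: sum_nonneg) (simp_all add: ampl_def)
qed

lemma kraus_matunit:
  assumes "x < n" "y < n" "i < m" "j < m"
  shows "kraus n m I V (matunit n x y) $$ (i,j) = (\<Sum>\<kappa>\<in>I. cnj (V \<kappa> x i) * V \<kappa> y j)"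
proof -
  have "(\<Sum>x'<n. \<Sum>y'<n. cnj (V \<kappa> x' i) * matunit n x y $$ (x',y') * V \<kappa> y' j) =
    (\<Sum>x'<n. \<Sum>y'<n. if x' = x \<and> y' = y then cnj (V \<kappa> x i) * V \<kappa> y j else 0)" for \<kappa>
    by (intro sum.cong refl) (auto simp: matunit_def)
  then show ?thesis using assms by (simp add: kraus_def sum_delta_pair)
qed

lemma tensor_map_kraus_gram:
  assumes X: "\<And>r s. r < n1 * n2 \<Longrightarrow> s < n1 * n2 \<Longrightarrow> X $$ (r,s) = (\<Sum>l\<in>L. \<beta> l r * cnj (\<beta> l s))"
    and "i < m1" "j < m1" "k < m2" "l < m2"
  shows "tensor_map n1 n2 m1 m2 (kraus n1 m1 I V) (kraus n2 m2 J W) X $$ (i * m2 + k, j * m2 + l) =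
    (\<Sum>\<kappa>\<in>I. \<Sum>\<mu>\<in>J. \<Sum>h\<in>L. cnj (\<Sum>x<n1. \<Sum>y<n2. V \<kappa> x i * cnj (\<beta> h (x * n2 + y)) * W \<mu> y k) *
       (\<Sum>x<n1. \<Sum>y<n2. V \<kappa> x j * cnj (\<beta> h (x * n2 + y)) * W \<mu> y l))"
proof -
  have "tensor_map n1 n2 m1 m2 (kraus n1 m1 I V) (kraus n2 m2 J W) X $$ (i * m2 + k, j * m2 + l) =
    (\<Sum>x<n1. \<Sum>x'<n1. \<Sum>y<n2. \<Sum>y'<n2. (\<Sum>h\<in>L. \<beta> h (x * n2 + y) * cnj (\<beta> h (x' * n2 + y'))) *
      (\<Sum>\<kappa>\<in>I. cnj (V \<kappa> x i) * V \<kappa> x' j) * (\<Sum>\<mu>\<in>J. cnj (W \<mu> y k) * W \<mu> y' l))"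
    using assms(2-) by (simp add: tensor_map_def mult_add_less kraus_matunit X)
  also have "\<dots> = (\<Sum>\<kappa>\<in>I. \<Sum>\<mu>\<in>J. \<Sum>h\<in>L. cnj (\<Sum>x<n1. \<Sum>y<n2. V \<kappa> x i * cnj (\<beta> h (x * n2 + y)) * W \<mu> y k) *
       (\<Sum>x<n1. \<Sum>y<n2. V \<kappa> x j * cnj (\<beta> h (x * n2 + y)) * W \<mu> y l))"
    unfolding sum_distrib_left sum_distrib_right sum.cartesian_product cnj_sum
    by (rule sum.reindex_bij_witness[of _
        "\<lambda>(\<kappa>,\<mu>,h,(x',y'),(x,y)). (x,x',y,y',\<mu>,\<kappa>,h)" "\<lambda>(x,x',y,y',\<mu>,\<kappa>,h). (\<kappa>,\<mu>,h,(x',y'),(x,y))"])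
      auto
  finally show ?thesis .
qed

lemma kraus_one_index:
  assumes "i < m" "j < m"
  shows "kraus n m I V (1\<^sub>m n) $$ (i,j) = (\<Sum>x<n. \<Sum>\<kappa>\<in>I. cnj (V \<kappa> x i) * V \<kappa> x j)"
proof -
  have "(\<Sum>y<n. cnj (V \<kappa> x i) * 1\<^sub>m n $$ (x,y) * V \<kappa> y j) = cnj (V \<kappa> x i) * V \<kappa> x j" if "x < n" for x \<kappa>
  proof -
    have "(\<Sum>y<n. cnj (V \<kappa> x i) * 1\<^sub>m n $$ (x,y) * V \<kappa> y j) =
        (\<Sum>y<n. if y = x then cnj (V \<kappa> x i) * V \<kappa> x j else 0)"
      using that by (intro sum.cong) auto
    then show ?thesis using that by simp
  qed
  then have "kraus n m I V (1\<^sub>m n) $$ (i,j) = (\<Sum>\<kappa>\<in>I. \<Sum>x<n. cnj (V \<kappa> x i) * V \<kappa> x j)"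
    using assms by (simp add: kraus_def)
  then show ?thesis by (simp only: sum.swap[of _ "{..<n}" I])
qed

text \<open>The identity on the product space is the product of identities, by uniqueness of the
  index pair. It turns completeness of a POVM into an equation between the two images of 1.\<close>

lemma tensor_map_one:
  assumes "i < m1" "j < m1" "k < m2" "l < m2"
  shows "tensor_map n1 n2 m1 m2 (kraus n1 m1 I V) (kraus n2 m2 J W) (1\<^sub>m (n1 * n2)) $$ (i * m2 + k, j * m2 + l) =
    kraus n1 m1 I V (1\<^sub>m n1) $$ (i,j) * kraus n2 m2 J W (1\<^sub>m n2) $$ (k,l)"
proof -
  have idx: "x * n2 + y = x' * n2 + y' \<longleftrightarrow> x = x' \<and> y = y'" if "y < n2" "y' < n2" for x y x' y'
    using that by (metis div_mult_self3 mod_mult_self3 div_less mod_less add.right_neutral less_nat_zero_code)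
  define K1 where "K1 x x' = kraus n1 m1 I V (matunit n1 x x') $$ (i,j)" for x x'
  define K2 where "K2 y y' = kraus n2 m2 J W (matunit n2 y y') $$ (k,l)" for y y'
  have "tensor_map n1 n2 m1 m2 (kraus n1 m1 I V) (kraus n2 m2 J W) (1\<^sub>m (n1 * n2)) $$ (i * m2 + k, j * m2 + l) =
    (\<Sum>x<n1. \<Sum>x'<n1. \<Sum>y<n2. \<Sum>y'<n2. 1\<^sub>m (n1 * n2) $$ (x * n2 + y, x' * n2 + y') * K1 x x' * K2 y y')"
    using assms by (simp add: tensor_map_def mult_add_less K1_def K2_def)
  also have "\<dots> = (\<Sum>x<n1. \<Sum>x'<n1. \<Sum>y<n2. \<Sum>y'<n2. if y' = y then if x' = x then K1 x x * K2 y y else 0 else 0)"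
    by (intro sum.cong refl) (auto simp: mult_add_less idx)
  also have "\<dots> = (\<Sum>x<n1. \<Sum>x'<n1. if x' = x then \<Sum>y<n2. K1 x x * K2 y y else 0)"
    by (intro sum.cong refl) auto
  also have "\<dots> = (\<Sum>x<n1. K1 x x) * (\<Sum>y<n2. K2 y y)"
    by (simp add: sum_product)
  also have "\<dots> = kraus n1 m1 I V (1\<^sub>m n1) $$ (i,j) * kraus n2 m2 J W (1\<^sub>m n2) $$ (k,l)"
    using assms by (simp add: K1_def K2_def kraus_matunit kraus_one_index)
  finally show ?thesis .
qed

lemma tensor_map_add:
  assumes "X \<in> carrier_mat (n1 * n2) (n1 * n2)" "Y \<in> carrier_mat (n1 * n2) (n1 * n2)"
  shows "tensor_map n1 n2 m1 m2 \<Lambda>1 \<Lambda>2 (X + Y) = tensor_map n1 n2 m1 m2 \<Lambda>1 \<Lambda>2 X + tensor_map n1 n2 m1 m2 \<Lambda>1 \<Lambda>2 Y"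
  using assms by (intro eq_matI)
    (auto simp: tensor_map_def mult_add_less distrib_right sum.distrib)

lemma tensor_map_smult:
  assumes "\<And>X. \<Lambda>1 X \<in> carrier_mat m1 m1" "\<And>X. \<Lambda>2 X \<in> carrier_mat m2 m2"
  shows "tensor_map n1 n2 m1 m2 (\<lambda>X. c \<cdot>\<^sub>m \<Lambda>1 X) (\<lambda>X. d \<cdot>\<^sub>m \<Lambda>2 X) X = (c * d) \<cdot>\<^sub>m tensor_map n1 n2 m1 m2 \<Lambda>1 \<Lambda>2 X"
proof (intro eq_matI)
  fix r s
  assume "r < dim_row ((c * d) \<cdot>\<^sub>m tensor_map n1 n2 m1 m2 \<Lambda>1 \<Lambda>2 X)" "s < dim_col ((c * d) \<cdot>\<^sub>m tensor_map n1 n2 m1 m2 \<Lambda>1 \<Lambda>2 X)"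
  then have rs: "r < m1 * m2" "s < m1 * m2" by (auto simp: tensor_map_def)
  have dims: "dim_row (\<Lambda>1 X) = m1" "dim_col (\<Lambda>1 X) = m1" "dim_row (\<Lambda>2 X) = m2" "dim_col (\<Lambda>2 X) = m2" for X
    using assms by (meson carrier_matD)+
  show "tensor_map n1 n2 m1 m2 (\<lambda>X. c \<cdot>\<^sub>m \<Lambda>1 X) (\<lambda>X. d \<cdot>\<^sub>m \<Lambda>2 X) X $$ (r, s) = ((c * d) \<cdot>\<^sub>m tensor_map n1 n2 m1 m2 \<Lambda>1 \<Lambda>2 X) $$ (r, s)"
    using rs less_mult_div_mod[OF rs(1)] less_mult_div_mod[OF rs(2)]
    by (simp add: tensor_map_def dims sum_distrib_left ac_simps)
qed (auto simp: tensor_map_def)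

lemma kraus_scale:
  "kraus n m I (\<lambda>\<kappa> x i. complex_of_real r * V \<kappa> x i) X = complex_of_real (r\<^sup>2) \<cdot>\<^sub>m kraus n m I V X"
  by (intro eq_matI) (auto simp: kraus_def sum_distrib_left power2_eq_square ac_simps intro!: sum.cong)

text \<open>The square root of the factor is absorbed into the Kraus operators.\<close>

lemma completely_positive_smult_kraus:
  assumes "c \<ge> 0"
  shows "completely_positive n m (\<lambda>X. complex_of_real c \<cdot>\<^sub>m kraus n m I V X)"
proof -
  have "(\<lambda>X. complex_of_real c \<cdot>\<^sub>m kraus n m I V X) = kraus n m I (\<lambda>\<kappa> x i. complex_of_real (sqrt c) * V \<kappa> x i)"
    using assms by (simp add: kraus_scale fun_eq_iff)
  then show ?thesis by (simp add: completely_positive_kraus)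
qed

section \<open>Post-measurement states\<close>

lemma local_op_mult_index:
  assumes B: "B \<in> carrier_mat dM dM" and \<tau>: "\<tau> \<in> carrier_mat (dA * dM * dC) (dA * dM * dC)"
    and lt: "a < dA" "m < dM" "c < dC" "r < dA * dM * dC"
  shows "(kron (kron (1\<^sub>m dA) B) (1\<^sub>m dC) * \<tau>) $$ ((a * dM + m) * dC + c, r) =
    (\<Sum>m'<dM. B $$ (m,m') * \<tau> $$ ((a * dM + m') * dC + c, r))"
proof -
  have K1: "kron (1\<^sub>m dA) B \<in> carrier_mat (dA * dM) (dA * dM)" using B by simp
  have K: "kron (kron (1\<^sub>m dA) B) (1\<^sub>m dC) \<in> carrier_mat (dA * dM * dC) (dA * dM * dC)" using K1 by simp
  have row: "(a * dM + m) * dC + c < dA * dM * dC" using lt by (simp add: mult_add_less)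
  have "(kron (kron (1\<^sub>m dA) B) (1\<^sub>m dC) * \<tau>) $$ ((a * dM + m) * dC + c, r) =
    (\<Sum>x<dA * dM * dC. kron (kron (1\<^sub>m dA) B) (1\<^sub>m dC) $$ ((a * dM + m) * dC + c, x) * \<tau> $$ (x, r))"
    using K \<tau> row lt by (simp add: scalar_prod_def atLeast0LessThan)
  also have "\<dots> = (\<Sum>a'<dA. \<Sum>m'<dM. \<Sum>c'<dC. 1\<^sub>m dA $$ (a,a') * B $$ (m,m') * 1\<^sub>m dC $$ (c,c') * \<tau> $$ ((a' * dM + m') * dC + c', r))"
    unfolding sum_lessThan_mult using lt B K1
    by (intro sum.cong refl) (simp add: index_kron[OF K1 one_carrier_mat] index_kron[OF one_carrier_mat B] mult_add_less)
  also have "\<dots> = (\<Sum>a'<dA. \<Sum>m'<dM. \<Sum>c'<dC. if c' = c then if a' = a then B $$ (m,m') * \<tau> $$ ((a * dM + m') * dC + c, r) else 0 else 0)"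
    using lt by (intro sum.cong refl) auto
  also have "\<dots> = (\<Sum>a'<dA. if a' = a then \<Sum>m'<dM. B $$ (m,m') * \<tau> $$ ((a * dM + m') * dC + c, r) else 0)"
    using lt by (intro sum.cong refl) auto
  also have "\<dots> = (\<Sum>m'<dM. B $$ (m,m') * \<tau> $$ ((a * dM + m') * dC + c, r))"
    using lt by simp
  finally show ?thesis .
qed

lemma ptrace_mid_index:
  assumes "a < dA" "c < dC" "a' < dA" "c' < dC"
  shows "ptrace_mid dA dM dC M $$ (a * dC + c, a' * dC + c') =
    (\<Sum>m<dM. M $$ ((a * dM + m) * dC + c, (a' * dM + m) * dC + c'))"
  using assms by (simp add: ptrace_mid_def mult_add_less add_mult_distrib)

lemma mtrace_ptrace_mid:
  assumes "M \<in> carrier_mat (dA * dM * dC) (dA * dM * dC)"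
  shows "mtrace (ptrace_mid dA dM dC M) = mtrace M"
proof -
  have "mtrace M = (\<Sum>a<dA. \<Sum>m<dM. \<Sum>c<dC. M $$ ((a * dM + m) * dC + c, (a * dM + m) * dC + c))"
    using assms by (simp add: mtrace_def sum_lessThan_mult del: index_mult_mat)
  also have "\<dots> = (\<Sum>a<dA. \<Sum>c<dC. \<Sum>m<dM. M $$ ((a * dM + m) * dC + c, (a * dM + m) * dC + c))"
    by (intro sum.cong sum.swap refl)
  also have "\<dots> = mtrace (ptrace_mid dA dM dC M)"
    \<comment> \<open>The definition is unfolded for the dimension only, so that entries are still
      evaluated by \<open>ptrace_mid_index\<close>.\<close>
    by (simp add: mtrace_def ptrace_mid_def[of dA dM dC M, THEN arg_cong[of _ _ dim_row]] sum_lessThan_mult ptrace_mid_index)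
  finally show ?thesis ..
qed

text \<open>For rank-one factors t, s and effect \<beta>, the middle systems are contracted with the
  bra of \<beta>, which leaves a pure vector on the outer two; the general case is the sum of
  these.\<close>

lemma ptrace_mid_gram:
  assumes \<tau>1: "\<tau>1 \<in> carrier_mat (dA * d1) (dA * d1)"
      "\<And>i j. i < dA * d1 \<Longrightarrow> j < dA * d1 \<Longrightarrow> \<tau>1 $$ (i,j) = (\<Sum>l\<in>I. t l i * cnj (t l j))"
    and \<tau>2: "\<tau>2 \<in> carrier_mat (d2 * dC) (d2 * dC)"
      "\<And>i j. i < d2 * dC \<Longrightarrow> j < d2 * dC \<Longrightarrow> \<tau>2 $$ (i,j) = (\<Sum>l\<in>J. s l i * cnj (s l j))"
    and B: "B \<in> carrier_mat (d1 * d2) (d1 * d2)"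
      "\<And>i j. i < d1 * d2 \<Longrightarrow> j < d1 * d2 \<Longrightarrow> B $$ (i,j) = (\<Sum>l\<in>L. \<beta> l i * cnj (\<beta> l j))"
    and lt: "a < dA" "c < dC" "a' < dA" "c' < dC"
  shows "ptrace_mid dA (d1 * d2) dC (kron (kron (1\<^sub>m dA) B) (1\<^sub>m dC) * kron \<tau>1 \<tau>2) $$ (a * dC + c, a' * dC + c') =
    (\<Sum>m\<in>I. \<Sum>n\<in>J. \<Sum>l\<in>L.
      (\<Sum>x<d1. \<Sum>y<d2. t m (a * d1 + x) * cnj (\<beta> l (x * d2 + y)) * s n (y * dC + c)) *
      cnj (\<Sum>x<d1. \<Sum>y<d2. t m (a' * d1 + x) * cnj (\<beta> l (x * d2 + y)) * s n (y * dC + c')))"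
proof -
  have d: "dA * d1 * (d2 * dC) = dA * (d1 * d2) * dC" by simp
  have \<tau>: "kron \<tau>1 \<tau>2 \<in> carrier_mat (dA * (d1 * d2) * dC) (dA * (d1 * d2) * dC)"
    using kron_carrier[OF \<tau>1(1) \<tau>2(1)] unfolding d .
  have col: "(a' * (d1 * d2) + m) * dC + c' < dA * (d1 * d2) * dC" if "m < d1 * d2" for m
    using lt that by (intro mult_add_less) auto
  \<comment> \<open>The fourfold index is grouped as A, B1 B2, C by the measurement but as A B1, B2
    C by the state.\<close>
  have idx: "(a * (d1 * d2) + (x * d2 + y)) * dC + c = (a * d1 + x) * (d2 * dC) + (y * dC + c)" for a x y c
    by (simp add: algebra_simps)
  have "ptrace_mid dA (d1 * d2) dC (kron (kron (1\<^sub>m dA) B) (1\<^sub>m dC) * kron \<tau>1 \<tau>2) $$ (a * dC + c, a' * dC + c') =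
    (\<Sum>m<d1 * d2. \<Sum>m'<d1 * d2. B $$ (m,m') *
       kron \<tau>1 \<tau>2 $$ ((a * (d1 * d2) + m') * dC + c, (a' * (d1 * d2) + m) * dC + c'))"
    unfolding ptrace_mid_index[OF lt]
    using lt by (intro sum.cong refl local_op_mult_index[OF B(1) \<tau>] col) auto
  also have "\<dots> = (\<Sum>x<d1. \<Sum>y<d2. \<Sum>x'<d1. \<Sum>y'<d2. (\<Sum>l\<in>L. \<beta> l (x * d2 + y) * cnj (\<beta> l (x' * d2 + y'))) *
     ((\<Sum>m\<in>I. t m (a * d1 + x') * cnj (t m (a' * d1 + x))) * (\<Sum>n\<in>J. s n (y' * dC + c) * cnj (s n (y * dC + c')))))"
    unfolding sum_lessThan_mult idx using lt
    by (intro sum.cong refl) (simp add: index_kron[OF \<tau>1(1) \<tau>2(1)] B(2) \<tau>1(2) \<tau>2(2) mult_add_less)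
  also have "\<dots> = (\<Sum>m\<in>I. \<Sum>n\<in>J. \<Sum>l\<in>L.
      (\<Sum>x<d1. \<Sum>y<d2. t m (a * d1 + x) * cnj (\<beta> l (x * d2 + y)) * s n (y * dC + c)) *
      cnj (\<Sum>x<d1. \<Sum>y<d2. t m (a' * d1 + x) * cnj (\<beta> l (x * d2 + y)) * s n (y * dC + c')))"
    unfolding sum_distrib_left sum_distrib_right sum.cartesian_product cnj_sum
    by (rule sum.reindex_bij_witness[of _
        "\<lambda>(m,n,l,(x,y),(x',y')). (x,y,x',y',(n,m),l)" "\<lambda>(x,y,x',y',(n,m),l). (m,n,l,(x,y),(x',y'))"])
      auto
  finally show ?thesis .
qed

section \<open>Saturation of the Tsirelson bound\<close>

text \<open>The Hilbert-Schmidt inner product, which is the usual inner product of bipartite vectors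
  when these are read as matrices.\<close>

definition hs :: "nat \<Rightarrow> nat \<Rightarrow> complex mat \<Rightarrow> complex mat \<Rightarrow> complex" where
  "hs m n X Y = (\<Sum>i<m. \<Sum>j<n. cnj (X $$ (i,j)) * Y $$ (i,j))"

lemma hs_self: "hs m n X X = complex_of_real (\<Sum>i<m. \<Sum>j<n. (cmod (X $$ (i,j)))\<^sup>2)"
  by (simp add: hs_def complex_norm_square mult.commute del: of_real_power)

lemma hs_self_nonneg: "0 \<le> hs m n X X"
  unfolding hs_self by (simp add: less_eq_complex_def sum_nonneg)

lemma hs_self_eq_0_iff:
  assumes "X \<in> carrier_mat m n"
  shows "hs m n X X = 0 \<longleftrightarrow> X = 0\<^sub>m m n"
proof
  assume "hs m n X X = 0"
  then have "(\<Sum>i<m. \<Sum>j<n. (cmod (X $$ (i,j)))\<^sup>2) = 0" unfolding hs_self by (simp only: of_real_eq_0_iff)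
  then show "X = 0\<^sub>m m n"
    using assms by (intro eq_matI) (auto simp: sum_nonneg_eq_0_iff sum_nonneg)
qed (simp add: hs_def)

lemma hermitian_opD:
  assumes "hermitian_op n M"
  shows "M \<in> carrier_mat n n" "i < n \<Longrightarrow> j < n \<Longrightarrow> cnj (M $$ (i,j)) = M $$ (j,i)"
proof -
  show M: "M \<in> carrier_mat n n" using assms by (simp add: hermitian_op_def)
  assume "i < n" "j < n"
  then have "adj M $$ (j,i) = cnj (M $$ (i,j))" using M by (simp add: adj_def)
  then show "cnj (M $$ (i,j)) = M $$ (j,i)" using assms by (simp add: hermitian_op_def)
qed

lemma hs_adj_left:
  assumes "hermitian_op m A" "X \<in> carrier_mat m n" "Y \<in> carrier_mat m n"
  shows "hs m n (A * X) Y = hs m n X (A * Y)"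
proof -
  note A = hermitian_opD[OF assms(1)]
  have "hs m n (A * X) Y = (\<Sum>i<m. \<Sum>j<n. (\<Sum>k<m. A $$ (k,i) * cnj (X $$ (k,j))) * Y $$ (i,j))"
    using assms A by (simp add: hs_def scalar_prod_def atLeast0LessThan)
  also have "\<dots> = (\<Sum>i<m. \<Sum>j<n. cnj (X $$ (i,j)) * (\<Sum>k<m. A $$ (i,k) * Y $$ (k,j)))"
    unfolding sum_distrib_left sum_distrib_right sum.cartesian_product
    by (rule sum.reindex_bij_witness[of _ "\<lambda>(i,j,k). (k,j,i)" "\<lambda>(i,j,k). (k,j,i)"]) auto
  also have "\<dots> = hs m n X (A * Y)"
    using assms A by (simp add: hs_def scalar_prod_def atLeast0LessThan)
  finally show ?thesis .
qed

lemma hs_adj_right: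
  assumes "hermitian_op n S" "X \<in> carrier_mat m n" "Y \<in> carrier_mat m n"
  shows "hs m n (X * S) Y = hs m n X (Y * S)"
proof -
  note S = hermitian_opD[OF assms(1)]
  have "hs m n (X * S) Y = (\<Sum>i<m. \<Sum>j<n. (\<Sum>k<n. S $$ (j,k) * cnj (X $$ (i,k))) * Y $$ (i,j))"
    using assms S by (simp add: hs_def scalar_prod_def atLeast0LessThan mult.commute)
  also have "\<dots> = (\<Sum>i<m. \<Sum>j<n. cnj (X $$ (i,j)) * (\<Sum>k<n. Y $$ (i,k) * S $$ (k,j)))"
    unfolding sum_distrib_left sum_distrib_right sum.cartesian_product
    by (rule sum.reindex_bij_witness[of _ "\<lambda>(i,j,k). (i,k,j)" "\<lambda>(i,j,k). (i,k,j)"]) auto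
  also have "\<dots> = hs m n X (Y * S)"
    using assms S by (simp add: hs_def scalar_prod_def atLeast0LessThan)
  finally show ?thesis .
qed

lemma hs_add_right:
  "X \<in> carrier_mat m n \<Longrightarrow> Y \<in> carrier_mat m n \<Longrightarrow> Z \<in> carrier_mat m n \<Longrightarrow>
    hs m n X (Y + Z) = hs m n X Y + hs m n X Z"
  by (simp add: hs_def distrib_left sum.distrib)

lemma hs_minus_smult_self:
  assumes "X \<in> carrier_mat m n" "Y \<in> carrier_mat m n" "s \<in> {1, -1}"
  shows "hs m n (X - s \<cdot>\<^sub>m Y) (X - s \<cdot>\<^sub>m Y) = hs m n X X - s * hs m n X Y - s * hs m n Y X + hs m n Y Y"
proof -
  have "cnj s = s" "s = 1 \<or> s = -1" using assms(3) by auto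
  then show ?thesis using assms(1,2)
    by (elim disjE) (simp_all add: hs_def algebra_simps sum.distrib sum_subtractf)
qed

text \<open>Side conditions on dimensions, unlike membership in \<open>carrier_mat\<close>, contain no
  unknowns, so that these versions work as rewrite rules.\<close>

lemma mult_mat_dim_simps:
  fixes A B C :: "complex mat"
  shows mult_assoc_dim: "dim_col A = dim_row B \<Longrightarrow> dim_col B = dim_row C \<Longrightarrow> A * (B * C) = A * B * C"
    and add_mult_dim: "dim_row A = dim_row B \<Longrightarrow> dim_col A = dim_row C \<Longrightarrow> dim_col B = dim_row C \<Longrightarrow>
      (A + B) * C = A * C + B * C"
    and mult_add_dim: "dim_col A = dim_row B \<Longrightarrow> dim_col A = dim_row C \<Longrightarrow> dim_col B = dim_col C \<Longrightarrow>
      A * (B + C) = A * B + A * C"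
    and minus_mult_dim: "dim_row A = dim_row B \<Longrightarrow> dim_col A = dim_row C \<Longrightarrow> dim_col B = dim_row C \<Longrightarrow>
      (A - B) * C = A * C - B * C"
    and mult_minus_dim: "dim_col A = dim_row B \<Longrightarrow> dim_col A = dim_row C \<Longrightarrow> dim_col B = dim_col C \<Longrightarrow>
      A * (B - C) = A * B - A * C"
    and smult_mult_dim: "dim_col A = dim_row B \<Longrightarrow> (k \<cdot>\<^sub>m A) * B = k \<cdot>\<^sub>m (A * B)"
    and mult_smult_dim: "dim_col A = dim_row B \<Longrightarrow> A * (k \<cdot>\<^sub>m B) = k \<cdot>\<^sub>m (A * B)"
proof -
  show "dim_col A = dim_row B \<Longrightarrow> dim_col B = dim_row C \<Longrightarrow> A * (B * C) = A * B * C"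
    by (rule assoc_mult_mat[symmetric]) auto
  show "dim_row A = dim_row B \<Longrightarrow> dim_col A = dim_row C \<Longrightarrow> dim_col B = dim_row C \<Longrightarrow>
      (A + B) * C = A * C + B * C"
    by (rule add_mult_distrib_mat) auto
  show "dim_col A = dim_row B \<Longrightarrow> dim_col A = dim_row C \<Longrightarrow> dim_col B = dim_col C \<Longrightarrow>
      A * (B + C) = A * B + A * C"
    by (rule mult_add_distrib_mat) auto
  show "dim_row A = dim_row B \<Longrightarrow> dim_col A = dim_row C \<Longrightarrow> dim_col B = dim_row C \<Longrightarrow>
      (A - B) * C = A * C - B * C"
    by (rule minus_mult_distrib_mat) auto
  show "dim_col A = dim_row B \<Longrightarrow> dim_col A = dim_row C \<Longrightarrow> dim_col B = dim_col C \<Longrightarrow>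
      A * (B - C) = A * B - A * C"
    by (rule mult_minus_distrib_mat) auto
  show "dim_col A = dim_row B \<Longrightarrow> (k \<cdot>\<^sub>m A) * B = k \<cdot>\<^sub>m (A * B)"
    by (rule mult_smult_assoc_mat) auto
  show "dim_col A = dim_row B \<Longrightarrow> A * (k \<cdot>\<^sub>m B) = k \<cdot>\<^sub>m (A * B)"
    by (rule mult_smult_distrib) auto
qed

text \<open>Tsirelson's sum-of-squares decomposition of \<open>2\<surd>2 - W\<close>, with states on a bipartite system
  read as matrices, so that the second party acts by right multiplication.\<close>

lemma chsh_sum_of_squares:
  assumes A: "hermitian_op m A0" "hermitian_op m A1" "A0 * A0 = 1\<^sub>m m" "A1 * A1 = 1\<^sub>m m"
    and C: "hermitian_op n S" "hermitian_op n D" "S * S + D * D = 2 \<cdot>\<^sub>m 1\<^sub>m n"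
    and \<phi>: "\<phi> \<in> carrier_mat m n" and st: "s \<in> {1, -1}" "t \<in> {1, -1}"
  shows "hs m n (A0 * \<phi> - s \<cdot>\<^sub>m (\<phi> * S)) (A0 * \<phi> - s \<cdot>\<^sub>m (\<phi> * S)) +
      hs m n (A1 * \<phi> - t \<cdot>\<^sub>m (\<phi> * D)) (A1 * \<phi> - t \<cdot>\<^sub>m (\<phi> * D)) =
    4 * hs m n \<phi> \<phi> - 2 * (s * hs m n \<phi> (A0 * \<phi> * S) + t * hs m n \<phi> (A1 * \<phi> * D))"
proof -
  \<comment> \<open>Expanding one square leaves a term with \<open>S * S\<close>. Only the sum of
    the two such terms is known, through \<open>S * S + D * D\<close>.\<close>
  have square: "hs m n (A * \<phi> - s \<cdot>\<^sub>m (\<phi> * S)) (A * \<phi> - s \<cdot>\<^sub>m (\<phi> * S)) =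
      hs m n \<phi> \<phi> - 2 * s * hs m n \<phi> (A * \<phi> * S) + hs m n \<phi> (\<phi> * (S * S))"
    if A: "hermitian_op m A" "A * A = 1\<^sub>m m" and S: "hermitian_op n S" and s: "s \<in> {1, -1}" for A S s
  proof -
    have [simp]: "A \<in> carrier_mat m m" "S \<in> carrier_mat n n" using A S by (auto simp: hermitian_op_def)
    have 1: "hs m n (A * \<phi>) (A * \<phi>) = hs m n \<phi> \<phi>"
    proof -
      have "hs m n (A * \<phi>) (A * \<phi>) = hs m n \<phi> (A * (A * \<phi>))"
        using \<phi> A(1) by (intro hs_adj_left mult_carrier_mat[of A m m \<phi> n]) simp_all
      also have "A * (A * \<phi>) = \<phi>"
        using A(2) \<phi> by (simp flip: assoc_mult_mat[of A m m A m \<phi> n])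
      finally show ?thesis .
    qed
    have 2: "hs m n (A * \<phi>) (\<phi> * S) = hs m n \<phi> (A * \<phi> * S)"
      using \<phi> A hs_adj_left[of m A \<phi> n "\<phi> * S"] assoc_mult_mat[of A m m \<phi> n S n] by simp
    have 3: "hs m n (\<phi> * S) (A * \<phi>) = hs m n \<phi> (A * \<phi> * S)"
      using \<phi> S by (intro hs_adj_right mult_carrier_mat[of A m m \<phi> n]) simp_all
    have 4: "hs m n (\<phi> * S) (\<phi> * S) = hs m n \<phi> (\<phi> * (S * S))"
      using \<phi> S hs_adj_right[of n S \<phi> m "\<phi> * S"] assoc_mult_mat[of \<phi> m n S n S n] by simp
    show ?thesis
      using hs_minus_smult_self[of "A * \<phi>" m n "\<phi> * S" s] mult_carrier_mat[of A m m \<phi> n] \<phi> s 1 2 3 4 by simp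
  qed
  have [simp]: "S \<in> carrier_mat n n" "D \<in> carrier_mat n n" using C by (auto simp: hermitian_op_def)
  have "hs m n \<phi> (\<phi> * (S * S)) + hs m n \<phi> (\<phi> * (D * D)) = hs m n \<phi> (\<phi> * (S * S + D * D))"
    using \<phi> by (subst mult_add_distrib_mat[of \<phi> m n _ n]) (auto intro!: hs_add_right[symmetric] mult_carrier_mat[of _ _ n])
  also have "\<phi> * (S * S + D * D) = 2 \<cdot>\<^sub>m \<phi>"
    using \<phi> unfolding C(3) by (simp add: mult_smult_distrib[of _ m n _ n])
  also have "hs m n \<phi> (2 \<cdot>\<^sub>m \<phi>) = 2 * hs m n \<phi> \<phi>"
    using \<phi> by (simp add: hs_def sum_distrib_left algebra_simps)
  finally show ?thesis
    using square[OF A(1,3) C(1) st(1)] square[OF A(2,4) C(2) st(2)] by (simp add: algebra_simps)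
qed

text \<open>Applying \<open>A\<close> twice on the left is applying \<open>S\<close> twice on the
  right, and the sign squares to 1. So \<open>S\<close> behaves as an involution on \<phi>.\<close>

lemma involution_transfer:
  fixes \<phi> :: "complex mat"
  assumes "A \<in> carrier_mat m m" "S \<in> carrier_mat n n" "\<phi> \<in> carrier_mat m n" "s \<in> {1, -1}"
    and "A * A = 1\<^sub>m m" "A * \<phi> = s \<cdot>\<^sub>m (\<phi> * S)"
  shows "\<phi> * S * S = \<phi>"
proof -
  have "\<phi> = A * (A * \<phi>)"
    using assms(1,3,5) by (simp flip: assoc_mult_mat[of A m m A m \<phi> n])
  also have "\<dots> = s \<cdot>\<^sub>m (s \<cdot>\<^sub>m (\<phi> * S * S))"
    using assms(1-3) unfolding assms(6)
    by (simp add: mult_mat_dim_simps assms(6) del: assoc_mult_mat)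
  also have "\<dots> = \<phi> * S * S"
    using assms(1-4) by (intro eq_matI) (auto simp del: assoc_mult_mat)
  finally show ?thesis ..
qed

section \<open>Vectors stabilized up to sign\<close>

text \<open>The branches of the swap isometry of self-testing, up to normalization: project onto the
  +1 eigenspace of \<open>A0\<close>, either directly or after a flip by \<open>A1\<close>.\<close>

definition frame_left :: "nat \<Rightarrow> complex mat \<Rightarrow> complex mat \<Rightarrow> nat \<Rightarrow> complex mat" where
  "frame_left m A0 A1 i = (if i = 0 then 1\<^sub>m m + A0 else (1\<^sub>m m + A0) * A1)"

text \<open>The same two branches for an action from the right, hence with the factors in reverse
  order.\<close>

definition frame_right :: "nat \<Rightarrow> complex mat \<Rightarrow> complex mat \<Rightarrow> nat \<Rightarrow> complex mat" where
  "frame_right n S D k = (if k = 0 then 1\<^sub>m n + S else D * (1\<^sub>m n + S))"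

text \<open>The coefficient of |ik> in sqrt 2 times the Bell state on which Z \<otimes> Z and X
  \<otimes> X have the eigenvalues \<open>s\<close> and \<open>t\<close>.\<close>

definition bell_coeff :: "complex \<Rightarrow> complex \<Rightarrow> nat \<Rightarrow> nat \<Rightarrow> complex" where
  "bell_coeff s t i k = (if (i = k) = (s = 1) then if i = 0 then 1 else t else 0)"

text \<open>\<open>A0\<close> with \<open>S\<close> plays the role of Z and \<open>A1\<close> with
  \<open>D\<close> that of X. The remaining Pauli relations (\<open>S\<close> and \<open>D\<close>
  squaring to 1, \<open>A0\<close> and \<open>A1\<close> anticommuting) are available only when
  applied to \<phi>.\<close>

locale stabilized =
  fixes m n :: nat and A0 A1 S D \<phi> :: "complex mat" and s t :: complex
  assumes A0 [simp]: "A0 \<in> carrier_mat m m" and A1 [simp]: "A1 \<in> carrier_mat m m"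
    and S [simp]: "S \<in> carrier_mat n n" and D [simp]: "D \<in> carrier_mat n n"
    and phi [simp]: "\<phi> \<in> carrier_mat m n"
    and sq: "A0 * A0 = 1\<^sub>m m" "A1 * A1 = 1\<^sub>m m"
    and anti: "S * D = - (D * S)"
    and st: "s \<in> {1, -1}" "t \<in> {1, -1}"
    and stab: "A0 * \<phi> = s \<cdot>\<^sub>m (\<phi> * S)" "A1 * \<phi> = t \<cdot>\<^sub>m (\<phi> * D)"
begin

lemma dims [simp]:
  "dim_row A0 = m" "dim_col A0 = m" "dim_row A1 = m" "dim_col A1 = m"
  "dim_row S = n" "dim_col S = n" "dim_row D = n" "dim_col D = n" "dim_row \<phi> = m" "dim_col \<phi> = n"
  using A0 A1 S D phi by (simp_all only: carrier_matD)

text \<open>Products are kept nested to the left and are not expanded into scalar products, so that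
  the rules for words such as \<open>\<phi> * S * S\<close> apply.\<close>

declare assoc_mult_mat [simp del] index_mult_mat(1) [simp del]
declare mult_mat_dim_simps [simp]

lemma phi_SS [simp]: "\<phi> * S * S = \<phi>"
  using A0 S phi st(1) sq(1) stab(1) by (rule involution_transfer)

lemma phi_DD [simp]: "\<phi> * D * D = \<phi>"
  using A1 D phi st(2) sq(2) stab(2) by (rule involution_transfer)

text \<open>Oriented so that \<open>S\<close> moves in front of \<open>D\<close>, which gives words
  in \<open>S\<close> and \<open>D\<close> a normal form.\<close>

lemma anti_right [simp]:
  assumes "dim_col X = n"
  shows "X * D * S = - (X * S * D)"
proof -
  have "D * S = - (S * D)" unfolding anti by (intro eq_matI) auto
  then have "X * (D * S) = X * - (S * D)" by simp
  then show ?thesis using assms by simp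
qed

text \<open>Moving \<open>S\<close> past both factors \<open>D\<close> costs two signs, which
  cancel; then \<open>phi_DD\<close> applies.\<close>

lemma phi_SDD: "\<phi> * S * D * D = \<phi> * S"
proof -
  have "\<phi> * S * D * D = - (\<phi> * D * S * D)" by simp
  also have "\<dots> = \<phi> * D * D * S" by (subst (2) anti_right) simp_all
  finally show ?thesis by simp
qed

lemma A0_A1_phi: "A0 * A1 * \<phi> = (s * t) \<cdot>\<^sub>m (\<phi> * S * D)"
proof -
  have "A0 * A1 * \<phi> = A0 * (A1 * \<phi>)" by simp
  also have "\<dots> = t \<cdot>\<^sub>m (A0 * \<phi> * D)" unfolding stab(2) by simp
  also have "\<dots> = (s * t) \<cdot>\<^sub>m (\<phi> * S * D)"
    unfolding stab(1) by (intro eq_matI) auto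
  finally show ?thesis .
qed

abbreviation u :: "nat \<Rightarrow> nat \<Rightarrow> complex mat" where
  "u i k \<equiv> frame_left m A0 A1 i * \<phi> * frame_right n S D k"

text \<open>Moving \<open>A0\<close> to the right of \<phi> produces the factor 1 + s here and 1 - s
  in \<open>u_01\<close>, so the sign \<open>s\<close> decides which of the two vanishes.\<close>

lemma u_00: "u 0 0 = (1 + s) \<cdot>\<^sub>m (\<phi> + \<phi> * S)"
  by (intro eq_matI) (auto simp: frame_left_def frame_right_def stab algebra_simps)

lemma u_01: "u 0 1 = (1 - s) \<cdot>\<^sub>m (\<phi> * D - \<phi> * S * D)"
  by (intro eq_matI) (auto simp: frame_left_def frame_right_def stab algebra_simps)

lemma u_10: "u 1 0 = t \<cdot>\<^sub>m u 0 1"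
  unfolding u_01
  by (intro eq_matI) (auto simp: frame_left_def frame_right_def stab A0_A1_phi algebra_simps)

lemma u_11: "u 1 1 = t \<cdot>\<^sub>m u 0 0"
  unfolding u_00
  by (intro eq_matI) (auto simp: frame_left_def frame_right_def stab A0_A1_phi phi_SDD algebra_simps)

text \<open>The frames do not annihilate a nonzero \<phi>. The surviving entry gives one linear
  relation between two words; multiplying it by \<open>D\<close> on the right and by
  \<open>A1\<close> on the left gives two relations with opposite relative signs, which kill both
  words.\<close>

lemma phi_eq_0:
  assumes "u 0 0 = 0\<^sub>m m n" "u 0 1 = 0\<^sub>m m n"
  shows "\<phi> = 0\<^sub>m m n"
proof -
  have t0: "t \<noteq> 0" using st by auto
  show ?thesis
  proof (cases "s = 1")
    case True
    have "(\<phi> + \<phi> * S) $$ (i,j) = 0" if "i < m" "j < n" for i j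
      using arg_cong[OF assms(1), of "\<lambda>M. M $$ (i,j)"] that True
      by (simp add: u_00 del: distrib_left_numeral)
    then have e: "\<phi> + \<phi> * S = 0\<^sub>m m n" by (intro eq_matI) auto
    have 1: "\<phi> * D + \<phi> * S * D = 0\<^sub>m m n"
      using arg_cong[OF e, of "\<lambda>M. M * D"] by simp
    have 2: "t \<cdot>\<^sub>m (\<phi> * D) + t \<cdot>\<^sub>m - (\<phi> * S * D) = 0\<^sub>m m n"
      using arg_cong[OF e, of "\<lambda>M. A1 * M"] by (simp add: stab)
    have "(\<phi> * D) $$ (i,j) = 0" if "i < m" "j < n" for i j
      using arg_cong[OF 1, of "\<lambda>M. M $$ (i,j)"] arg_cong[OF 2, of "\<lambda>M. M $$ (i,j)"] that t0
      by simp
    then have "\<phi> * D = 0\<^sub>m m n" by (intro eq_matI) auto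
    then have "\<phi> * D * D = 0\<^sub>m m n * D" by (simp only:)
    then show ?thesis by simp
  next
    case False
    then have s: "s = -1" using st by auto
    have "(\<phi> * D - \<phi> * S * D) $$ (i,j) = 0" if "i < m" "j < n" for i j
      using arg_cong[OF assms(2), of "\<lambda>M. M $$ (i,j)"] that s
      unfolding u_01 by (simp del: right_diff_distrib_numeral)
    then have e: "\<phi> * D - \<phi> * S * D = 0\<^sub>m m n" by (intro eq_matI) auto
    have 1: "\<phi> - \<phi> * S = 0\<^sub>m m n"
      using arg_cong[OF e, of "\<lambda>M. M * D"] by (simp add: phi_SDD)
    have 2: "t \<cdot>\<^sub>m \<phi> - t \<cdot>\<^sub>m - (\<phi> * S) = 0\<^sub>m m n"
      using arg_cong[OF e, of "\<lambda>M. A1 * M"] by (simp add: stab phi_SDD)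
    have "\<phi> $$ (i,j) = 0" if "i < m" "j < n" for i j
      using arg_cong[OF 1, of "\<lambda>M. M $$ (i,j)"] arg_cong[OF 2, of "\<lambda>M. M $$ (i,j)"] that t0
      by simp
    then show ?thesis by (intro eq_matI) auto
  qed
qed

text \<open>The Bell state splits off as a tensor factor. The remaining factor \<open>w\<close> is
  \<open>u 0 0\<close> or \<open>u 0 1\<close>, whichever the sign \<open>s\<close> leaves.\<close>

lemma frame_eq_bell_coeff:
  obtains w where "w = 0\<^sub>m m n \<Longrightarrow> \<phi> = 0\<^sub>m m n" "w \<in> carrier_mat m n"
    "\<And>i k. i < 2 \<Longrightarrow> k < 2 \<Longrightarrow> u i k = bell_coeff s t i k \<cdot>\<^sub>m w"
proof -
  have c: "u 0 0 \<in> carrier_mat m n" "u 0 1 \<in> carrier_mat m n"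
    unfolding u_00 u_01 by (auto intro!: carrier_matI)
  have one: "1 \<cdot>\<^sub>m X = X" "0 \<cdot>\<^sub>m X = 0\<^sub>m (dim_row X) (dim_col X)" for X :: "complex mat"
    by (auto intro!: eq_matI)
  have s: "s = 1 \<or> s = -1" using st by auto
  have z: "u 0 1 = 0\<^sub>m m n" if "s = 1"
    unfolding u_01 using that by (auto intro!: eq_matI)
  have z': "u 0 0 = 0\<^sub>m m n" if "s \<noteq> 1"
    unfolding u_00 using that s by (auto intro!: eq_matI)
  have t0: "t \<cdot>\<^sub>m 0\<^sub>m m n = 0\<^sub>m m n" by (auto intro!: eq_matI)
  have eq: "u i k = bell_coeff s t i k \<cdot>\<^sub>m (if s = 1 then u 0 0 else u 0 1)" if "i < 2" "k < 2" for i k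
  proof -
    note dims_u = carrier_matD[OF c(1)] carrier_matD[OF c(2)]
    have ik: "i = 0 \<or> i = 1" "k = 0 \<or> k = 1" using that by auto
    show ?thesis
    proof (cases "s = 1")
      case True
      from ik show ?thesis
        by (elim disjE; simp only: u_10 u_11 z[OF True] t0)
          (simp_all only: True bell_coeff_def one dims_u simp_thms if_True if_False zero_neq_one one_neq_zero)
    next
      case False
      from ik show ?thesis
        by (elim disjE; simp only: u_10 u_11 z'[OF False] t0)
          (simp_all only: False bell_coeff_def one dims_u simp_thms if_True if_False zero_neq_one one_neq_zero)
    qed
  qed
  have nz: "\<phi> = 0\<^sub>m m n" if "(if s = 1 then u 0 0 else u 0 1) = 0\<^sub>m m n"
    using that phi_eq_0 z z' by (cases "s = 1") (simp_all only: if_True if_False simp_thms)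
  have cw: "(if s = 1 then u 0 0 else u 0 1) \<in> carrier_mat m n"
    using c by (cases "s = 1") (simp_all only: if_True if_False simp_thms)
  show ?thesis
    by (rule that[OF nz cw eq])
qed

end

section \<open>Expectation values and Charlie's rotated observables\<close>

lemma mult3_index:
  assumes "X \<in> carrier_mat m p" "Y \<in> carrier_mat p q" "Z \<in> carrier_mat q n" "a < m" "c < n"
  shows "(X * Y * Z) $$ (a,c) = (\<Sum>x<p. \<Sum>y<q. X $$ (a,x) * Y $$ (x,y) * Z $$ (y,c))"
proof -
  have XY: "X * Y \<in> carrier_mat m q" using assms by (intro mult_carrier_mat)
  have "(X * Y * Z) $$ (a,c) = (\<Sum>y<q. (\<Sum>x<p. X $$ (a,x) * Y $$ (x,y)) * Z $$ (y,c))"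
    using assms XY by (simp add: scalar_prod_def atLeast0LessThan del: assoc_mult_mat)
  also have "\<dots> = (\<Sum>x<p. \<Sum>y<q. X $$ (a,x) * Y $$ (x,y) * Z $$ (y,c))"
    unfolding sum_distrib_right by (rule sum.swap)
  finally show ?thesis .
qed

text \<open>The expectation of a Bell operator in a mixture is the sum of its expectations in the
  vectors. \<open>S\<close> and \<open>D\<close> occur with transposed indices because Charlie acts
  from the right.\<close>

lemma mtrace_mult_gram:
  assumes W: "W \<in> carrier_mat (m * n) (m * n)"
      "\<And>a c a' c'. a < m \<Longrightarrow> c < n \<Longrightarrow> a' < m \<Longrightarrow> c' < n \<Longrightarrow>
        W $$ (a * n + c, a' * n + c') = q * (s * (A0 $$ (a,a') * S $$ (c',c)) + t * (A1 $$ (a,a') * D $$ (c',c)))"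
    and \<sigma>: "\<sigma> \<in> carrier_mat (m * n) (m * n)"
      "\<And>a c a' c'. a < m \<Longrightarrow> c < n \<Longrightarrow> a' < m \<Longrightarrow> c' < n \<Longrightarrow>
        \<sigma> $$ (a * n + c, a' * n + c') = (\<Sum>\<kappa>\<in>K. \<phi> \<kappa> $$ (a,c) * cnj (\<phi> \<kappa> $$ (a',c')))"
    and carr: "A0 \<in> carrier_mat m m" "A1 \<in> carrier_mat m m" "S \<in> carrier_mat n n" "D \<in> carrier_mat n n"
      "\<And>\<kappa>. \<kappa> \<in> K \<Longrightarrow> \<phi> \<kappa> \<in> carrier_mat m n"
  shows "mtrace (W * \<sigma>) = q * (\<Sum>\<kappa>\<in>K. s * hs m n (\<phi> \<kappa>) (A0 * \<phi> \<kappa> * S) + t * hs m n (\<phi> \<kappa>) (A1 * \<phi> \<kappa> * D))"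
proof -
  have summand: "(\<Sum>a<m. \<Sum>c<n. \<Sum>a'<m. \<Sum>c'<n. A $$ (a,a') * S $$ (c',c) * (\<Sum>\<kappa>\<in>K. \<phi> \<kappa> $$ (a',c') * cnj (\<phi> \<kappa> $$ (a,c))))
      = (\<Sum>\<kappa>\<in>K. hs m n (\<phi> \<kappa>) (A * \<phi> \<kappa> * S))"
    if "A \<in> carrier_mat m m" "S \<in> carrier_mat n n" for A S
  proof -
    have "(\<Sum>\<kappa>\<in>K. hs m n (\<phi> \<kappa>) (A * \<phi> \<kappa> * S)) = (\<Sum>\<kappa>\<in>K. \<Sum>a<m. \<Sum>c<n. cnj (\<phi> \<kappa> $$ (a,c)) *
        (\<Sum>a'<m. \<Sum>c'<n. A $$ (a,a') * \<phi> \<kappa> $$ (a',c') * S $$ (c',c)))"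
      unfolding hs_def using that carr(5) by (intro sum.cong refl) (simp add: mult3_index[of _ m m _ n _ n] del: index_mult_mat)
    also have "\<dots> = (\<Sum>a<m. \<Sum>c<n. \<Sum>a'<m. \<Sum>c'<n. A $$ (a,a') * S $$ (c',c) * (\<Sum>\<kappa>\<in>K. \<phi> \<kappa> $$ (a',c') * cnj (\<phi> \<kappa> $$ (a,c))))"
      unfolding sum_distrib_left sum.cartesian_product
      by (rule sum.reindex_bij_witness[of _ "\<lambda>(a,c,a',c',\<kappa>). (\<kappa>,a,c,a',c')" "\<lambda>(\<kappa>,a,c,a',c'). (a,c,a',c',\<kappa>)"]) auto
    finally show ?thesis ..
  qed
  have "mtrace (W * \<sigma>) = (\<Sum>r<m * n. \<Sum>r'<m * n. W $$ (r,r') * \<sigma> $$ (r',r))"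
    using W(1) \<sigma>(1) by (simp add: mtrace_def scalar_prod_def atLeast0LessThan)
  also have "\<dots> = (\<Sum>a<m. \<Sum>c<n. \<Sum>a'<m. \<Sum>c'<n. q * (s * (A0 $$ (a,a') * S $$ (c',c)) + t * (A1 $$ (a,a') * D $$ (c',c))) *
       (\<Sum>\<kappa>\<in>K. \<phi> \<kappa> $$ (a',c') * cnj (\<phi> \<kappa> $$ (a,c))))"
    unfolding sum_lessThan_mult by (intro sum.cong refl) (simp add: W(2) \<sigma>(2))
  also have "\<dots> = q * (s * (\<Sum>a<m. \<Sum>c<n. \<Sum>a'<m. \<Sum>c'<n. A0 $$ (a,a') * S $$ (c',c) * (\<Sum>\<kappa>\<in>K. \<phi> \<kappa> $$ (a',c') * cnj (\<phi> \<kappa> $$ (a,c))))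
     + t * (\<Sum>a<m. \<Sum>c<n. \<Sum>a'<m. \<Sum>c'<n. A1 $$ (a,a') * D $$ (c',c) * (\<Sum>\<kappa>\<in>K. \<phi> \<kappa> $$ (a',c') * cnj (\<phi> \<kappa> $$ (a,c)))))"
    by (simp only: distrib_left distrib_right sum.distrib mult.assoc flip: sum_distrib_left)
  also have "\<dots> = q * (\<Sum>\<kappa>\<in>K. s * hs m n (\<phi> \<kappa>) (A0 * \<phi> \<kappa> * S) + t * hs m n (\<phi> \<kappa>) (A1 * \<phi> \<kappa> * D))"
    unfolding summand[OF carr(1,3)] summand[OF carr(2,4)] by (simp only: sum.distrib sum_distrib_left)
  finally show ?thesis .
qed

text \<open>With P and Q the transposes of \<open>C0\<close> and \<open>C1\<close>, (P + Q)^2 + (P -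
  Q)^2 = 2 P^2 + 2 Q^2, and the anticommutator of P + Q and P - Q is 2 P^2 - 2 Q^2 = 0.\<close>

lemma chsh_rotation:
  assumes C: "hermitian_op n C0" "hermitian_op n C1" "C0 * C0 = 1\<^sub>m n" "C1 * C1 = 1\<^sub>m n"
    and S: "S = complex_of_real (1 / sqrt 2) \<cdot>\<^sub>m transpose_mat (C0 + C1)"
    and D: "D = complex_of_real (1 / sqrt 2) \<cdot>\<^sub>m transpose_mat (C0 - C1)"
  shows "hermitian_op n S" "hermitian_op n D" "S * S + D * D = 2 \<cdot>\<^sub>m 1\<^sub>m n" "S * D = - (D * S)"
proof -
  note H = hermitian_opD[OF C(1)] hermitian_opD[OF C(2)]
  have d [simp]: "dim_row C0 = n" "dim_col C0 = n" "dim_row C1 = n" "dim_col C1 = n"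
    using H by auto
  define q where "q = complex_of_real (1 / sqrt 2)"
  have q2: "q * (q * x) = x / 2" for x
  proof -
    have "q * q = 1 / 2" by (simp add: q_def flip: of_real_mult)
    then show ?thesis by (simp flip: mult.assoc)
  qed
  define P where "P = transpose_mat C0"
  define Q where "Q = transpose_mat C1"
  have [simp]: "dim_row P = n" "dim_col P = n" "dim_row Q = n" "dim_col Q = n" by (simp_all add: P_def Q_def)
  have sq: "P * P = 1\<^sub>m n" "Q * Q = 1\<^sub>m n"
    using C(3,4) H by (simp_all add: P_def Q_def flip: transpose_mult[of _ n n _ n])
  have S': "S = q \<cdot>\<^sub>m (P + Q)" and D': "D = q \<cdot>\<^sub>m (P - Q)"
    unfolding S D q_def P_def Q_def by (auto intro!: eq_matI)
  show "hermitian_op n S" "hermitian_op n D"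
    unfolding hermitian_op_def adj_def S' D' P_def Q_def q_def
    by (auto intro!: eq_matI simp: H)
  show "S * S + D * D = 2 \<cdot>\<^sub>m 1\<^sub>m n"
    unfolding S' D'
    by (intro eq_matI) (auto simp: mult_mat_dim_simps sq q2 algebra_simps simp del: assoc_mult_mat index_mult_mat(1))
  show "S * D = - (D * S)"
    unfolding S' D'
    by (intro eq_matI) (auto simp: mult_mat_dim_simps sq q2 algebra_simps simp del: assoc_mult_mat index_mult_mat(1))
qed

section \<open>Bell states\<close>

text \<open>The eigenvalue of Z \<otimes> Z on the \<open>b\<close>-th Bell state;
  \<open>xx_sign\<close> is the one of X \<otimes> X.\<close>

definition zz_sign :: "nat \<Rightarrow> complex" where
  "zz_sign b = (if b < 2 then 1 else -1)"

definition xx_sign :: "nat \<Rightarrow> complex" where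
  "xx_sign b = (if b = 0 \<or> b = 2 then 1 else -1)"

text \<open>Collecting the terms of each observable of Alice turns all four operators into one
  formula that differs only in the stabilizer signs of the Bell state.\<close>

lemma bell_op_index:
  assumes "A0 \<in> carrier_mat m m" "A1 \<in> carrier_mat m m" "C0 \<in> carrier_mat n n" "C1 \<in> carrier_mat n n" "b < 4"
    and S: "S = complex_of_real (1 / sqrt 2) \<cdot>\<^sub>m transpose_mat (C0 + C1)"
    and D: "D = complex_of_real (1 / sqrt 2) \<cdot>\<^sub>m transpose_mat (C0 - C1)"
  shows "bell_op A0 A1 C0 C1 b \<in> carrier_mat (m * n) (m * n)"
    and "a < m \<Longrightarrow> c < n \<Longrightarrow> a' < m \<Longrightarrow> c' < n \<Longrightarrow>
      bell_op A0 A1 C0 C1 b $$ (a * n + c, a' * n + c') = complex_of_real (sqrt 2) *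
        (zz_sign b * (A0 $$ (a,a') * S $$ (c',c)) + xx_sign b * (A1 $$ (a,a') * D $$ (c',c)))"
proof -
  have K: "kron A C \<in> carrier_mat (m * n) (m * n)" if "A \<in> carrier_mat m m" "C \<in> carrier_mat n n" for A C
    using that by simp
  note Ks = K[OF assms(1,3)] K[OF assms(1,4)] K[OF assms(2,3)] K[OF assms(2,4)]
  note dims = carrier_matD[OF Ks(1)] carrier_matD[OF Ks(2)] carrier_matD[OF Ks(3)] carrier_matD[OF Ks(4)]
  show "bell_op A0 A1 C0 C1 b \<in> carrier_mat (m * n) (m * n)"
    unfolding bell_op_def Let_def using dims by (auto intro!: carrier_matI)
  assume lt: "a < m" "c < n" "a' < m" "c' < n"
  have b: "b = 0 \<or> b = 1 \<or> b = 2 \<or> b = 3" using assms(5) by auto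
  have "complex_of_real (sqrt 2) * S $$ (c',c) = C0 $$ (c,c') + C1 $$ (c,c')"
    "complex_of_real (sqrt 2) * D $$ (c',c) = C0 $$ (c,c') - C1 $$ (c,c')"
    using lt assms(3,4) by (simp_all add: S D)
  then have "complex_of_real (sqrt 2) * (zz_sign b * (A0 $$ (a,a') * S $$ (c',c)) + xx_sign b * (A1 $$ (a,a') * D $$ (c',c))) =
    zz_sign b * A0 $$ (a,a') * (C0 $$ (c,c') + C1 $$ (c,c')) + xx_sign b * A1 $$ (a,a') * (C0 $$ (c,c') - C1 $$ (c,c'))"
    by (simp add: distrib_left mult.left_commute)
  moreover have "bell_op A0 A1 C0 C1 b $$ (a * n + c, a' * n + c') =
    zz_sign b * A0 $$ (a,a') * (C0 $$ (c,c') + C1 $$ (c,c')) + xx_sign b * A1 $$ (a,a') * (C0 $$ (c,c') - C1 $$ (c,c'))"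
    using b lt assms(1-4)
    by (elim disjE; simp add: bell_op_def Let_def zz_sign_def xx_sign_def dims mult_add_less index_kron[of _ m m _ n n])
      (simp_all add: algebra_simps)
  ultimately show "bell_op A0 A1 C0 C1 b $$ (a * n + c, a' * n + c') = complex_of_real (sqrt 2) *
        (zz_sign b * (A0 $$ (a,a') * S $$ (c',c)) + xx_sign b * (A1 $$ (a,a') * D $$ (c',c)))"
    by simp
qed

lemma bell_proj_index:
  assumes "b < 4" "i < 2" "k < 2" "j < 2" "l < 2"
  shows "bell_proj b $$ (i * 2 + k, j * 2 + l) =
    bell_coeff (zz_sign b) (xx_sign b) i k * bell_coeff (zz_sign b) (xx_sign b) j l / 2"
proof -
  define q where "q = complex_of_real (1 / sqrt 2)"
  have vec: "bell_vec b $ (i * 2 + k) = q * bell_coeff (zz_sign b) (xx_sign b) i k"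
    if "i < 2" "k < 2" for i k
  proof -
    have "b = 0 \<or> b = 1 \<or> b = 2 \<or> b = 3" "i = 0 \<or> i = 1" "k = 0 \<or> k = 1" using that assms(1) by auto
    then show ?thesis
      by (elim disjE) (auto simp: bell_vec_def bell_coeff_def zz_sign_def xx_sign_def q_def numeral_2_eq_2 numeral_3_eq_3)
  qed
  have q2: "q * q = 1 / 2" by (simp add: q_def flip: of_real_mult)
  have "cnj (bell_coeff (zz_sign b) (xx_sign b) j l) = bell_coeff (zz_sign b) (xx_sign b) j l"
    by (simp add: bell_coeff_def zz_sign_def xx_sign_def)
  moreover have "i * 2 + k < 4" "j * 2 + l < 4" "cnj q = q" using assms by (auto simp: q_def)
  ultimately have "bell_proj b $$ (i * 2 + k, j * 2 + l) = (q * q) *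
     (bell_coeff (zz_sign b) (xx_sign b) i k * bell_coeff (zz_sign b) (xx_sign b) j l)"
    using assms by (simp add: bell_proj_def vec del: One_nat_def)
  then show ?thesis unfolding q2 by simp
qed

section \<open>From a maximal violation to a Bell projector\<close>

text \<open>Sandwiching the effect vectors between the Kraus operators reproduces the entries of
  \<open>F i * \<phi> * G k\<close>, that is, Bell coefficients times entries of \<open>w\<close>;
  summing the rank-one terms gives the projector. \<open>V\<close> and \<open>W\<close> do not
  involve \<open>b\<close>, so the same pair of maps serves all outcomes.\<close>

lemma tensor_map_outcome_eq_bell:
  fixes I :: "'i set" and J :: "'j set" and L :: "'l set"
    and r1 :: "'i \<Rightarrow> nat \<Rightarrow> complex" and r2 :: "'j \<Rightarrow> nat \<Rightarrow> complex" and \<beta> :: "'l \<Rightarrow> nat \<Rightarrow> complex"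
  assumes V: "V = (\<lambda>(g,a) x i. (frame_left dA A0 A1 i * mat dA d1 (\<lambda>(a,x). r1 g (a * d1 + x))) $$ (a,x))"
    and W: "W = (\<lambda>(h,c) y k. (mat d2 dC (\<lambda>(y,c). r2 h (y * dC + c)) * frame_right dC S D k) $$ (y,c))"
    and fin: "finite I" "finite J" "finite L"
    and \<tau>1: "\<tau>1 \<in> carrier_mat (dA * d1) (dA * d1)"
      "\<And>i j. i < dA * d1 \<Longrightarrow> j < dA * d1 \<Longrightarrow> \<tau>1 $$ (i,j) = (\<Sum>g\<in>I. r1 g i * cnj (r1 g j))"
    and \<tau>2: "\<tau>2 \<in> carrier_mat (d2 * dC) (d2 * dC)"
      "\<And>i j. i < d2 * dC \<Longrightarrow> j < d2 * dC \<Longrightarrow> \<tau>2 $$ (i,j) = (\<Sum>h\<in>J. r2 h i * cnj (r2 h j))"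
    and E: "E \<in> carrier_mat (d1 * d2) (d1 * d2)"
      "\<And>i j. i < d1 * d2 \<Longrightarrow> j < d1 * d2 \<Longrightarrow> E $$ (i,j) = (\<Sum>l\<in>L. \<beta> l i * cnj (\<beta> l j))"
    and A: "hermitian_op dA A0" "hermitian_op dA A1" "A0 * A0 = 1\<^sub>m dA" "A1 * A1 = 1\<^sub>m dA"
    and C: "hermitian_op dC C0" "hermitian_op dC C1" "C0 * C0 = 1\<^sub>m dC" "C1 * C1 = 1\<^sub>m dC"
    and S: "S = complex_of_real (1 / sqrt 2) \<cdot>\<^sub>m transpose_mat (C0 + C1)"
    and D: "D = complex_of_real (1 / sqrt 2) \<cdot>\<^sub>m transpose_mat (C0 - C1)"
    and b: "b < 4"
    and p: "outcome_prob dA dC E (kron \<tau>1 \<tau>2) \<noteq> 0"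
    and max: "mtrace (bell_op A0 A1 C0 C1 b * post_state dA (d1 * d2) dC E (kron \<tau>1 \<tau>2)) = complex_of_real (2 * sqrt 2)"
  shows "\<exists>c>0. \<forall>i<2. \<forall>j<2. \<forall>k<2. \<forall>l<2.
    tensor_map d1 d2 2 2 (kraus d1 2 (I \<times> {..<dA}) V) (kraus d2 2 (J \<times> {..<dC}) W) E $$ (i * 2 + k, j * 2 + l) =
      complex_of_real c * bell_proj b $$ (i * 2 + k, j * 2 + l)"
proof -
  define s where "s = zz_sign b"
  define t where "t = xx_sign b"
  have st: "s \<in> {1, -1}" "t \<in> {1, -1}" by (auto simp: s_def t_def zz_sign_def xx_sign_def)
  note CR = chsh_rotation[OF C S D]
  have carr: "A0 \<in> carrier_mat dA dA" "A1 \<in> carrier_mat dA dA" "C0 \<in> carrier_mat dC dC" "C1 \<in> carrier_mat dC dC"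
    "S \<in> carrier_mat dC dC" "D \<in> carrier_mat dC dC"
    using A C CR by (simp_all add: hermitian_op_def)
  define R1 where "R1 g = mat dA d1 (\<lambda>(a,x). r1 g (a * d1 + x))" for g
  define R2 where "R2 h = mat d2 dC (\<lambda>(y,c). r2 h (y * dC + c))" for h
  define \<beta>c where "\<beta>c l = mat d1 d2 (\<lambda>(x,y). cnj (\<beta> l (x * d2 + y)))" for l
  have R: "R1 g \<in> carrier_mat dA d1" "R2 h \<in> carrier_mat d2 dC" "\<beta>c l \<in> carrier_mat d1 d2" for g h l
    by (simp_all add: R1_def R2_def \<beta>c_def)
  define K where "K = I \<times> J \<times> L"
  have finK: "finite K" using fin by (simp add: K_def)
  define \<phi> where "\<phi> = (\<lambda>(g,h,l). R1 g * \<beta>c l * R2 h)"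
  have \<phi>: "\<phi> \<kappa> \<in> carrier_mat dA dC" for \<kappa>
    by (auto simp: \<phi>_def split: prod.splits intro!: mult_carrier_mat[OF mult_carrier_mat[OF R(1) R(3)] R(2)])
  define \<sigma> where "\<sigma> = ptrace_mid dA (d1 * d2) dC (kron (kron (1\<^sub>m dA) E) (1\<^sub>m dC) * kron \<tau>1 \<tau>2)"
  have \<sigma>_carr: "\<sigma> \<in> carrier_mat (dA * dC) (dA * dC)" by (simp add: \<sigma>_def ptrace_mid_def)
  have \<phi>_index: "\<phi> (g,h,l) $$ (a,c) =
      (\<Sum>x<d1. \<Sum>y<d2. r1 g (a * d1 + x) * cnj (\<beta> l (x * d2 + y)) * r2 h (y * dC + c))"
    if "a < dA" "c < dC" for g h l a c
    unfolding \<phi>_def prod.case mult3_index[OF R(1,3,2) that] using that by (simp add: R1_def R2_def \<beta>c_def)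
  have \<sigma>_gram: "\<sigma> $$ (a * dC + c, a' * dC + c') = (\<Sum>\<kappa>\<in>K. \<phi> \<kappa> $$ (a,c) * cnj (\<phi> \<kappa> $$ (a',c')))"
    if "a < dA" "c < dC" "a' < dA" "c' < dC" for a c a' c'
  proof -
    have "\<sigma> $$ (a * dC + c, a' * dC + c') = (\<Sum>g\<in>I. \<Sum>h\<in>J. \<Sum>l\<in>L. \<phi> (g,h,l) $$ (a,c) * cnj (\<phi> (g,h,l) $$ (a',c')))"
      unfolding \<sigma>_def \<phi>_index[OF that(1,2)] \<phi>_index[OF that(3,4)]
      by (rule ptrace_mid_gram[OF \<tau>1 \<tau>2 E that])
    then show ?thesis by (simp add: K_def sum.cartesian_product split_def)
  qed
  define p where "p = outcome_prob dA dC E (kron \<tau>1 \<tau>2)"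
  have d: "dA * d1 * (d2 * dC) = dA * (d1 * d2) * dC" by simp
  have "p = mtrace \<sigma>"
  proof -
    have "kron (kron (1\<^sub>m dA) E) (1\<^sub>m dC) \<in> carrier_mat (dA * (d1 * d2) * dC) (dA * (d1 * d2) * dC)"
      using E by simp
    moreover have "kron \<tau>1 \<tau>2 \<in> carrier_mat (dA * (d1 * d2) * dC) (dA * (d1 * d2) * dC)"
      using kron_carrier[OF \<tau>1(1) \<tau>2(1)] unfolding d .
    ultimately show ?thesis unfolding p_def outcome_prob_def \<sigma>_def
      by (intro mtrace_ptrace_mid[symmetric] mult_carrier_mat)
  qed
  also have "mtrace \<sigma> = (\<Sum>a<dA. \<Sum>c<dC. \<Sum>\<kappa>\<in>K. \<phi> \<kappa> $$ (a,c) * cnj (\<phi> \<kappa> $$ (a,c)))"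
    using \<sigma>_carr by (simp add: mtrace_def sum_lessThan_mult \<sigma>_gram)
  also have "\<dots> = (\<Sum>\<kappa>\<in>K. hs dA dC (\<phi> \<kappa>) (\<phi> \<kappa>))"
    unfolding hs_def sum.cartesian_product
    by (rule sum.reindex_bij_witness[of _ "\<lambda>(\<kappa>,a,c). (a,c,\<kappa>)" "\<lambda>(a,c,\<kappa>). (\<kappa>,a,c)"]) auto
  finally have p_eq: "p = (\<Sum>\<kappa>\<in>K. hs dA dC (\<phi> \<kappa>) (\<phi> \<kappa>))" .
  note W_carr = bell_op_index(1)[OF carr(1-4) b S D]
  define Q where "Q \<kappa> = s * hs dA dC (\<phi> \<kappa>) (A0 * \<phi> \<kappa> * S) + t * hs dA dC (\<phi> \<kappa>) (A1 * \<phi> \<kappa> * D)" for \<kappa>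
  have "mtrace (bell_op A0 A1 C0 C1 b * \<sigma>) = complex_of_real (sqrt 2) * (\<Sum>\<kappa>\<in>K. Q \<kappa>)"
    unfolding Q_def s_def t_def
    by (rule mtrace_mult_gram[OF W_carr bell_op_index(2)[OF carr(1-4) b S D] \<sigma>_carr \<sigma>_gram carr(1,2,5,6) \<phi>])
  moreover have "mtrace (bell_op A0 A1 C0 C1 b * post_state dA (d1 * d2) dC E (kron \<tau>1 \<tau>2)) =
      mtrace (bell_op A0 A1 C0 C1 b * \<sigma>) / p"
  proof -
    have "post_state dA (d1 * d2) dC E (kron \<tau>1 \<tau>2) = (1 / p) \<cdot>\<^sub>m \<sigma>"
      by (simp add: post_state_def p_def \<sigma>_def)
    then have "bell_op A0 A1 C0 C1 b * post_state dA (d1 * d2) dC E (kron \<tau>1 \<tau>2) = (1 / p) \<cdot>\<^sub>m (bell_op A0 A1 C0 C1 b * \<sigma>)"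
      by (simp add: mult_smult_distrib[OF W_carr \<sigma>_carr])
    then show ?thesis using W_carr \<sigma>_carr by (simp add: mtrace_def sum_divide_distrib del: index_mult_mat(1))
  qed
  ultimately have "complex_of_real (2 * sqrt 2) = complex_of_real (sqrt 2) * (\<Sum>\<kappa>\<in>K. Q \<kappa>) / p"
    using max by simp
  \<comment> \<open>The normalization by \<open>p\<close> cancels, and the factor
    \<open>sqrt 2\<close> of \<open>bell_op_index\<close> accounts for the rest of the Tsirelson
    value.\<close>
  then have sumQ: "(\<Sum>\<kappa>\<in>K. Q \<kappa>) = 2 * p"
    using p unfolding p_def[symmetric] by (simp add: field_simps)
  define X where "X \<kappa> = A0 * \<phi> \<kappa> - s \<cdot>\<^sub>m (\<phi> \<kappa> * S)" for \<kappa>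
  define Y where "Y \<kappa> = A1 * \<phi> \<kappa> - t \<cdot>\<^sub>m (\<phi> \<kappa> * D)" for \<kappa>
  have XY: "hs dA dC (X \<kappa>) (X \<kappa>) + hs dA dC (Y \<kappa>) (Y \<kappa>) = 4 * hs dA dC (\<phi> \<kappa>) (\<phi> \<kappa>) - 2 * Q \<kappa>" for \<kappa>
    unfolding X_def Y_def Q_def by (rule chsh_sum_of_squares[OF A CR(1-3) \<phi> st])
  \<comment> \<open>Summed over the mixture, the sums of squares total 4p - 2 * 2p = 0; being
    nonnegative, each of them vanishes.\<close>
  have "(\<Sum>\<kappa>\<in>K. hs dA dC (X \<kappa>) (X \<kappa>) + hs dA dC (Y \<kappa>) (Y \<kappa>)) = 4 * p - 2 * (\<Sum>\<kappa>\<in>K. Q \<kappa>)"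
    unfolding XY p_eq by (simp add: sum_subtractf sum_distrib_left)
  then have "(\<Sum>\<kappa>\<in>K. hs dA dC (X \<kappa>) (X \<kappa>) + hs dA dC (Y \<kappa>) (Y \<kappa>)) = 0"
    unfolding sumQ by simp
  then have zero: "hs dA dC (X \<kappa>) (X \<kappa>) = 0 \<and> hs dA dC (Y \<kappa>) (Y \<kappa>) = 0" if "\<kappa> \<in> K" for \<kappa>
    using that finK hs_self_nonneg by (simp add: sum_nonneg_eq_0_iff add_nonneg_eq_0_iff)
  have XYc: "X \<kappa> \<in> carrier_mat dA dC" "Y \<kappa> \<in> carrier_mat dA dC" for \<kappa>
    using carr \<phi>[of \<kappa>] by (auto simp: X_def Y_def intro!: minus_carrier_mat)
  have stab: "stabilized dA dC A0 A1 S D (\<phi> \<kappa>) s t" if "\<kappa> \<in> K" for \<kappa>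
  proof -
    have mz: "U = V" if "U - V = 0\<^sub>m dA dC" "U \<in> carrier_mat dA dC" "V \<in> carrier_mat dA dC" for U V :: "complex mat"
    proof (rule eq_matI)
      fix i j assume "i < dim_row V" "j < dim_col V"
      then show "U $$ (i,j) = V $$ (i,j)"
        using arg_cong[OF that(1), of "\<lambda>M. M $$ (i,j)"] that(2,3) by simp
    qed (use that in auto)
    have c: "A0 * \<phi> \<kappa> \<in> carrier_mat dA dC" "A1 * \<phi> \<kappa> \<in> carrier_mat dA dC"
      "\<phi> \<kappa> * S \<in> carrier_mat dA dC" "\<phi> \<kappa> * D \<in> carrier_mat dA dC"
      using carr \<phi>[of \<kappa>] by auto
    have "X \<kappa> = 0\<^sub>m dA dC" "Y \<kappa> = 0\<^sub>m dA dC"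
      using zero[OF that] XYc by (simp_all add: hs_self_eq_0_iff)
    then have "A0 * \<phi> \<kappa> = s \<cdot>\<^sub>m (\<phi> \<kappa> * S)" "A1 * \<phi> \<kappa> = t \<cdot>\<^sub>m (\<phi> \<kappa> * D)"
      using c unfolding X_def Y_def by (auto intro!: mz)
    then show ?thesis using carr \<phi> A CR st by unfold_locales auto
  qed
  have "\<exists>w. (w = 0\<^sub>m dA dC \<longrightarrow> \<phi> \<kappa> = 0\<^sub>m dA dC) \<and> w \<in> carrier_mat dA dC \<and>
     (\<forall>i<2. \<forall>k<2. frame_left dA A0 A1 i * \<phi> \<kappa> * frame_right dC S D k = bell_coeff s t i k \<cdot>\<^sub>m w)" if "\<kappa> \<in> K" for \<kappa>
    by (rule stabilized.frame_eq_bell_coeff[OF stab[OF that]]) blast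
  then obtain w where w: "\<And>\<kappa>. \<kappa> \<in> K \<Longrightarrow> w \<kappa> = 0\<^sub>m dA dC \<Longrightarrow> \<phi> \<kappa> = 0\<^sub>m dA dC"
    "\<And>\<kappa>. \<kappa> \<in> K \<Longrightarrow> w \<kappa> \<in> carrier_mat dA dC"
    "\<And>\<kappa> i k. \<kappa> \<in> K \<Longrightarrow> i < 2 \<Longrightarrow> k < 2 \<Longrightarrow> frame_left dA A0 A1 i * \<phi> \<kappa> * frame_right dC S D k = bell_coeff s t i k \<cdot>\<^sub>m w \<kappa>"
    by metis
  define N where "N = (\<Sum>\<kappa>\<in>K. hs dA dC (w \<kappa>) (w \<kappa>))"
  have "N \<ge> 0" unfolding N_def by (intro sum_nonneg hs_self_nonneg)
  \<comment> \<open>If all \<open>w\<close> vanished, so would all \<phi>, and the outcome would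
    have probability 0.\<close>
  moreover have "N \<noteq> 0"
  proof
    assume "N = 0"
    then have "hs dA dC (w \<kappa>) (w \<kappa>) = 0" if "\<kappa> \<in> K" for \<kappa>
      using that finK hs_self_nonneg by (simp add: N_def sum_nonneg_eq_0_iff)
    then have "\<phi> \<kappa> = 0\<^sub>m dA dC" if "\<kappa> \<in> K" for \<kappa>
      using w(1,2) that by (simp add: hs_self_eq_0_iff)
    then have "p = 0" unfolding p_eq using \<phi> by (auto simp: hs_self_eq_0_iff intro!: sum.neutral)
    then show False using p by (simp add: p_def)
  qed
  ultimately obtain c where c: "c > 0" "N = complex_of_real c"
    by (intro that[of "Re N"]) (auto simp: less_eq_complex_def complex_eq_iff)
  have V_W: "(\<Sum>x<d1. \<Sum>y<d2. V (g,a) x i * cnj (\<beta> l (x * d2 + y)) * W (h,c) y k) = bell_coeff s t i k * w (g,h,l) $$ (a,c)"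
    if "a < dA" "c < dC" "i < 2" "k < 2" "(g,h,l) \<in> K" for g h l a c i k
  proof -
    have F: "frame_left dA A0 A1 i \<in> carrier_mat dA dA" "frame_right dC S D k \<in> carrier_mat dC dC"
      using carr by (auto simp: frame_left_def frame_right_def)
    have "(\<Sum>x<d1. \<Sum>y<d2. V (g,a) x i * cnj (\<beta> l (x * d2 + y)) * W (h,c) y k) =
      (\<Sum>x<d1. \<Sum>y<d2. (frame_left dA A0 A1 i * R1 g) $$ (a,x) * \<beta>c l $$ (x,y) * (R2 h * frame_right dC S D k) $$ (y,c))"
      by (simp add: V W R1_def R2_def \<beta>c_def del: index_mult_mat(1))
    also have "\<dots> = (frame_left dA A0 A1 i * R1 g * \<beta>c l * (R2 h * frame_right dC S D k)) $$ (a,c)"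
      by (rule mult3_index[OF mult_carrier_mat[OF F(1) R(1)] R(3) mult_carrier_mat[OF R(2) F(2)] that(1,2), symmetric])
    \<comment> \<open>Associativity alone joins the state factors inside the Kraus operators with
      the effect, which restores \<phi>.\<close>
    also have "frame_left dA A0 A1 i * R1 g * \<beta>c l * (R2 h * frame_right dC S D k) =
      frame_left dA A0 A1 i * \<phi> (g,h,l) * frame_right dC S D k"
      using carrier_matD[OF R(1)[of g]] carrier_matD[OF R(2)[of h]] carrier_matD[OF R(3)[of l]] carrier_matD[OF F(1)] carrier_matD[OF F(2)]
      by (simp add: \<phi>_def mult_assoc_dim del: assoc_mult_mat)
    also have "\<dots> $$ (a,c) = bell_coeff s t i k * w (g,h,l) $$ (a,c)"
      unfolding w(3)[OF that(5,3,4)] using w(2)[OF that(5)] that by simp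
    finally show ?thesis .
  qed
  have cnj_bc: "cnj (bell_coeff s t i k) = bell_coeff s t i k" for i k
    using st by (auto simp: bell_coeff_def)
  show ?thesis
  \<comment> \<open>The 2 makes up for the factor 1/2 in \<open>bell_proj_index\<close>.\<close>
  proof (intro exI[of _ "2 * c"] conjI allI impI)
    fix i j k l :: nat assume lt: "i < 2" "j < 2" "k < 2" "l < 2"
    have "tensor_map d1 d2 2 2 (kraus d1 2 (I \<times> {..<dA}) V) (kraus d2 2 (J \<times> {..<dC}) W) E $$ (i * 2 + k, j * 2 + l) =
      (\<Sum>\<kappa>\<in>I \<times> {..<dA}. \<Sum>\<mu>\<in>J \<times> {..<dC}. \<Sum>h\<in>L. cnj (\<Sum>x<d1. \<Sum>y<d2. V \<kappa> x i * cnj (\<beta> h (x * d2 + y)) * W \<mu> y k) *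
       (\<Sum>x<d1. \<Sum>y<d2. V \<kappa> x j * cnj (\<beta> h (x * d2 + y)) * W \<mu> y l))"
      by (rule tensor_map_kraus_gram[OF E(2) lt])
    also have "\<dots> = (\<Sum>g\<in>I. \<Sum>a<dA. \<Sum>h\<in>J. \<Sum>c<dC. \<Sum>e\<in>L.
        cnj (bell_coeff s t i k * w (g,h,e) $$ (a,c)) * (bell_coeff s t j l * w (g,h,e) $$ (a,c)))"
      unfolding sum.cartesian_product' using lt by (auto intro!: sum.cong simp: V_W K_def simp del: cnj_sum)
    also have "\<dots> = (\<Sum>\<kappa>\<in>K. \<Sum>a<dA. \<Sum>c<dC. bell_coeff s t i k * bell_coeff s t j l * (cnj (w \<kappa> $$ (a,c)) * w \<kappa> $$ (a,c)))"
      unfolding K_def sum.cartesian_product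
      by (rule sum.reindex_bij_witness[of _ "\<lambda>((g,h,e),a,c). (g,a,h,c,e)" "\<lambda>(g,a,h,c,e). ((g,h,e),a,c)"])
        (auto simp: cnj_bc)
    also have "\<dots> = bell_coeff s t i k * bell_coeff s t j l * N"
      by (simp add: N_def hs_def sum_distrib_left)
    also have "\<dots> = complex_of_real (2 * c) * bell_proj b $$ (i * 2 + k, j * 2 + l)"
      unfolding bell_proj_index[OF b lt(1,3,2,4)] by (simp add: c(2) s_def t_def)
    finally show "tensor_map d1 d2 2 2 (kraus d1 2 (I \<times> {..<dA}) V) (kraus d2 2 (J \<times> {..<dC}) W) E $$ (i * 2 + k, j * 2 + l) =
      complex_of_real (2 * c) * bell_proj b $$ (i * 2 + k, j * 2 + l)" .
  qed (use c in simp)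
qed

section \<open>Normalization and assembly of the two maps\<close>

lemma kraus_one_diag_nonneg:
  assumes "i < m"
  shows "0 \<le> kraus n m I V (1\<^sub>m n) $$ (i,i)"
  unfolding kraus_one_index[OF assms assms] by (intro sum_nonneg) (simp add: less_eq_complex_def)

text \<open>Comparison of entries: the diagonal ones force equal diagonals in each factor, the
  entries that vanish in every Bell projector then kill the off-diagonals, and the remaining ones
  equate the weights.\<close>

lemma kron_eq_bell_mixture:
  assumes c: "\<And>b. b < 4 \<Longrightarrow> (c :: nat \<Rightarrow> real) b > 0"
    and eq: "\<And>i j k l. i < 2 \<Longrightarrow> j < 2 \<Longrightarrow> k < 2 \<Longrightarrow> l < 2 \<Longrightarrow>
      \<alpha> $$ (i,j) * \<gamma> $$ (k,l) = (\<Sum>b<4. complex_of_real (c b) * bell_proj b $$ (i * 2 + k, j * 2 + l))"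
    and carr: "\<alpha> \<in> carrier_mat 2 2" "\<gamma> \<in> carrier_mat 2 2"
    and pos: "0 \<le> \<alpha> $$ (0,0)" "0 \<le> \<alpha> $$ (1,1)" "0 \<le> \<gamma> $$ (0,0)"
  obtains x y where "x > 0" "y > 0" "\<alpha> = complex_of_real x \<cdot>\<^sub>m 1\<^sub>m 2" "\<gamma> = complex_of_real y \<cdot>\<^sub>m 1\<^sub>m 2"
    "\<And>b. b < 4 \<Longrightarrow> c b = x * y"
proof -
  have sum4: "(\<Sum>b<4. f b) = f 0 + f 1 + f 2 + f 3" for f :: "nat \<Rightarrow> complex"
    by (simp add: eval_nat_numeral)
  have ent: "\<alpha> $$ (i,j) * \<gamma> $$ (k,l) =
      (\<Sum>b<4. complex_of_real (c b) * (bell_coeff (zz_sign b) (xx_sign b) i k * bell_coeff (zz_sign b) (xx_sign b) j l / 2))"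
    if "i < 2" "j < 2" "k < 2" "l < 2" for i j k l
    unfolding eq[OF that] using that by (intro sum.cong refl) (simp add: bell_proj_index)
  have d: "\<alpha> $$ (0,0) * \<gamma> $$ (0,0) = (c 0 + c 1) / 2" "\<alpha> $$ (1,1) * \<gamma> $$ (1,1) = (c 0 + c 1) / 2"
    "\<alpha> $$ (0,0) * \<gamma> $$ (1,1) = (c 2 + c 3) / 2" "\<alpha> $$ (1,1) * \<gamma> $$ (0,0) = (c 2 + c 3) / 2"
    using ent[of 0 0 0 0] ent[of 1 1 1 1] ent[of 0 0 1 1] ent[of 1 1 0 0]
    by (simp_all add: sum4 bell_coeff_def zz_sign_def xx_sign_def field_simps)
  have o: "\<alpha> $$ (0,1) * \<gamma> $$ (0,0) = 0" "\<alpha> $$ (1,0) * \<gamma> $$ (0,0) = 0"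
    "\<alpha> $$ (0,0) * \<gamma> $$ (0,1) = 0" "\<alpha> $$ (0,0) * \<gamma> $$ (1,0) = 0"
    "\<alpha> $$ (0,1) * \<gamma> $$ (0,1) = (c 0 - c 1) / 2" "\<alpha> $$ (0,1) * \<gamma> $$ (1,0) = (c 2 - c 3) / 2"
    using ent[of 0 1 0 0] ent[of 1 0 0 0] ent[of 0 0 0 1] ent[of 0 0 1 0] ent[of 0 1 0 1] ent[of 0 1 1 0]
    by (simp_all add: sum4 bell_coeff_def zz_sign_def xx_sign_def field_simps)
  obtain x x' y where xy: "\<alpha> $$ (0,0) = complex_of_real x" "\<alpha> $$ (1,1) = complex_of_real x'" "\<gamma> $$ (0,0) = complex_of_real y"
    "x \<ge> 0" "x' \<ge> 0" "y \<ge> 0"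
    using pos by (intro that[of "Re (\<alpha> $$ (0,0))" "Re (\<alpha> $$ (1,1))" "Re (\<gamma> $$ (0,0))"])
      (auto simp: less_eq_complex_def complex_eq_iff)
  have c4: "c 0 > 0" "c 1 > 0" "c 2 > 0" "c 3 > 0" using c by auto
  have 1: "x * y = (c 0 + c 1) / 2" "x' * y = (c 2 + c 3) / 2"
    using d(1,4) unfolding xy by (simp_all flip: of_real_mult add: complex_eq_iff)
  \<comment> \<open>Positive weights keep these products away from 0, which licenses all
    cancellations below.\<close>
  then have xp: "x > 0" "y > 0" "x' > 0"
    using c4 xy(4-6) by (auto simp: less_le)
  define y' where "y' = \<gamma> $$ (1,1)"
  have y'_eq: "complex_of_real x' * y' = complex_of_real x * complex_of_real y"
    "complex_of_real x * y' = complex_of_real x' * complex_of_real y"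
    using d unfolding xy y'_def by (simp_all only:)
  \<comment> \<open>Evaluating x x' y' by each of the two relations eliminates y' and leaves x'^2 =
    x^2.\<close>
  have "complex_of_real (x' * x' * y) = complex_of_real x' * (complex_of_real x * y')"
    by (simp add: y'_eq)
  also have "\<dots> = complex_of_real x * (complex_of_real x' * y')" by (rule mult.left_commute)
  also have "\<dots> = complex_of_real (x * x * y)" by (simp add: y'_eq)
  finally have "complex_of_real (x' * x' * y) = complex_of_real (x * x * y)" .
  then have "x' * x' * y = x * x * y" by (simp only: of_real_eq_iff)
  then have "x' * x' = x * x" using xp by simp
  then have x': "x' = x" using xp by (simp add: power2_eq_square[symmetric])
  have y': "y' = complex_of_real y"
    using y'_eq(1) xp x' by simp
  have z: "\<alpha> $$ (0,1) = 0" "\<alpha> $$ (1,0) = 0" "\<gamma> $$ (0,1) = 0" "\<gamma> $$ (1,0) = 0"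
    using o(1-4) xp unfolding xy by auto
  have "c 0 = c 1" "c 2 = c 3"
    using o(5,6) unfolding z by (simp_all add: complex_eq_iff)
  then have cxy: "c 0 = x * y" "c 1 = x * y" "c 2 = x * y" "c 3 = x * y" using 1 x' by simp_all
  show ?thesis
  proof (rule that[OF xp(1,2)])
    have ext: "M = N" if "M \<in> carrier_mat 2 2" "N \<in> carrier_mat 2 2" "M $$ (0,0) = N $$ (0,0)"
      "M $$ (0,1) = N $$ (0,1)" "M $$ (1,0) = N $$ (1,0)" "M $$ (1,1) = N $$ (1,1)" for M N :: "complex mat"
    proof (rule eq_matI)
      fix i j assume "i < dim_row N" "j < dim_col N"
      then have "i = 0 \<or> i = 1" "j = 0 \<or> j = 1" using that(2) by auto
      then show "M $$ (i,j) = N $$ (i,j)" using that(3-) by (elim disjE) simp_all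
    qed (use that in auto)
    show "\<alpha> = complex_of_real x \<cdot>\<^sub>m 1\<^sub>m 2"
      by (rule ext[OF carr(1)]) (use xy x' z in auto)
    show "\<gamma> = complex_of_real y \<cdot>\<^sub>m 1\<^sub>m 2"
      by (rule ext[OF carr(2)]) (use xy y'[unfolded y'_def] z in auto)
    fix b :: nat assume "b < 4"
    then have "b = 0 \<or> b = 1 \<or> b = 2 \<or> b = 3" by auto
    then show "c b = x * y" using cxy by auto
  qed
qed

theorem theorem1:
  fixes dA dB1 dB2 dC :: nat
    and \<tau>AB1 \<tau>B2C A0 A1 C0 C1 :: "complex mat"
    and B :: "nat \<Rightarrow> complex mat"
  assumes "density_op (dA * dB1) \<tau>AB1"
    and "density_op (dB2 * dC) \<tau>B2C"
    and "povm4 (dB1 * dB2) B"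
    and "hermitian_op dA A0" and "hermitian_op dA A1"
    and "hermitian_op dC C0" and "hermitian_op dC C1"
    and "A0 * A0 = 1\<^sub>m dA" and "A1 * A1 = 1\<^sub>m dA"
    and "C0 * C0 = 1\<^sub>m dC" and "C1 * C1 = 1\<^sub>m dC"
    and "\<forall>b<4. Re (outcome_prob dA dC (B b) (kron \<tau>AB1 \<tau>B2C)) > 0
              \<and> Im (outcome_prob dA dC (B b) (kron \<tau>AB1 \<tau>B2C)) = 0"
    and "\<forall>b<4. mtrace (bell_op A0 A1 C0 C1 b *
                 post_state dA (dB1 * dB2) dC (B b) (kron \<tau>AB1 \<tau>B2C))
               = complex_of_real (2 * sqrt 2)"
  shows "\<exists>\<Lambda>1 \<Lambda>2. completely_positive dB1 2 \<Lambda>1 \<and> unital dB1 2 \<Lambda>1 \<and>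
                 completely_positive dB2 2 \<Lambda>2 \<and> unital dB2 2 \<Lambda>2 \<and>
                 (\<forall>b<4. tensor_map dB1 dB2 2 2 \<Lambda>1 \<Lambda>2 (B b) = bell_proj b)"
proof -
  have psd: "psd (dA * dB1) \<tau>AB1" "psd (dB2 * dC) \<tau>B2C" "\<And>b. b < 4 \<Longrightarrow> psd (dB1 * dB2) (B b)"
    and sumB: "B 0 + B 1 + B 2 + B 3 = 1\<^sub>m (dB1 * dB2)"
    using assms(1-3) by (auto simp: density_op_def povm4_def)
  have carr: "\<tau>AB1 \<in> carrier_mat (dA * dB1) (dA * dB1)" "\<tau>B2C \<in> carrier_mat (dB2 * dC) (dB2 * dC)"
    "\<And>b. b < 4 \<Longrightarrow> B b \<in> carrier_mat (dB1 * dB2) (dB1 * dB2)"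
    using psd by (simp_all add: psd_def)
  obtain r1 where r1: "\<And>i j. i < dA * dB1 \<Longrightarrow> j < dA * dB1 \<Longrightarrow>
      \<tau>AB1 $$ (i,j) = (\<Sum>g<dA * dB1. r1 g i * cnj (r1 g j))"
    using psd_gram[OF psd(1)] by blast
  obtain r2 where r2: "\<And>i j. i < dB2 * dC \<Longrightarrow> j < dB2 * dC \<Longrightarrow>
      \<tau>B2C $$ (i,j) = (\<Sum>g<dB2 * dC. r2 g i * cnj (r2 g j))"
    using psd_gram[OF psd(2)] by blast
  define S where "S = complex_of_real (1 / sqrt 2) \<cdot>\<^sub>m transpose_mat (C0 + C1)"
  define D where "D = complex_of_real (1 / sqrt 2) \<cdot>\<^sub>m transpose_mat (C0 - C1)"
  define V where "V = (\<lambda>(g,a) x i. (frame_left dA A0 A1 i * mat dA dB1 (\<lambda>(a,x). r1 g (a * dB1 + x))) $$ (a,x))"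
  define W where "W = (\<lambda>(h,c) y k. (mat dB2 dC (\<lambda>(y,c). r2 h (y * dC + c)) * frame_right dC S D k) $$ (y,c))"
  define \<Lambda>1 where "\<Lambda>1 = kraus dB1 2 ({..<dA * dB1} \<times> {..<dA}) V"
  define \<Lambda>2 where "\<Lambda>2 = kraus dB2 2 ({..<dB2 * dC} \<times> {..<dC}) W"
  define \<alpha> where "\<alpha> = \<Lambda>1 (1\<^sub>m dB1)"
  define \<gamma> where "\<gamma> = \<Lambda>2 (1\<^sub>m dB2)"
  \<comment> \<open>Only the decomposition of \<open>B b\<close> and the weight depend on
    \<open>b\<close>; the two maps are already fixed.\<close>
  have "\<exists>c>0. \<forall>i<2. \<forall>j<2. \<forall>k<2. \<forall>l<2. tensor_map dB1 dB2 2 2 \<Lambda>1 \<Lambda>2 (B b) $$ (i * 2 + k, j * 2 + l) =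
      complex_of_real c * bell_proj b $$ (i * 2 + k, j * 2 + l)" if b: "b < 4" for b
  proof -
    obtain \<beta> where \<beta>: "\<And>i j. i < dB1 * dB2 \<Longrightarrow> j < dB1 * dB2 \<Longrightarrow>
      B b $$ (i,j) = (\<Sum>g<dB1 * dB2. \<beta> g i * cnj (\<beta> g j))"
      using psd_gram[OF psd(3)[OF b]] by blast
    have "outcome_prob dA dC (B b) (kron \<tau>AB1 \<tau>B2C) \<noteq> 0" using assms(12) b by force
    then show ?thesis unfolding \<Lambda>1_def \<Lambda>2_def
      using assms(13) b
      by (intro tensor_map_outcome_eq_bell[OF V_def W_def _ _ _ carr(1) r1 carr(2) r2 carr(3)[OF b] \<beta>
         assms(4,5,8,9,6,7,10,11) S_def D_def b]) auto
  qed
  then obtain c where c: "\<And>b. b < 4 \<Longrightarrow> c b > 0"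
    "\<And>b i j k l. b < 4 \<Longrightarrow> i < 2 \<Longrightarrow> j < 2 \<Longrightarrow> k < 2 \<Longrightarrow> l < 2 \<Longrightarrow>
      tensor_map dB1 dB2 2 2 \<Lambda>1 \<Lambda>2 (B b) $$ (i * 2 + k, j * 2 + l) = complex_of_real (c b) * bell_proj b $$ (i * 2 + k, j * 2 + l)"
    by metis
  have "\<alpha> $$ (i,j) * \<gamma> $$ (k,l) = (\<Sum>b<4. complex_of_real (c b) * bell_proj b $$ (i * 2 + k, j * 2 + l))"
    if "i < 2" "j < 2" "k < 2" "l < 2" for i j k l
  proof -
    have lt: "i * 2 + k < 4" "j * 2 + l < 4" using that by auto
    have dims: "dim_row (tensor_map dB1 dB2 2 2 \<Lambda>1 \<Lambda>2 X) = 4" "dim_col (tensor_map dB1 dB2 2 2 \<Lambda>1 \<Lambda>2 X) = 4" for X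
      by (simp_all add: tensor_map_def)
    \<comment> \<open>Completeness of the measurement makes the sum of the four images the image of
      the identity.\<close>
    have "\<alpha> $$ (i,j) * \<gamma> $$ (k,l) = tensor_map dB1 dB2 2 2 \<Lambda>1 \<Lambda>2 (B 0 + B 1 + B 2 + B 3) $$ (i * 2 + k, j * 2 + l)"
      unfolding sumB \<alpha>_def \<gamma>_def \<Lambda>1_def \<Lambda>2_def using that by (rule tensor_map_one[symmetric])
    also have "\<dots> = (\<Sum>b<4. tensor_map dB1 dB2 2 2 \<Lambda>1 \<Lambda>2 (B b) $$ (i * 2 + k, j * 2 + l))"
      using lt carr(3)[of 0] carr(3)[of 1] carr(3)[of 2] carr(3)[of 3]
      by (simp add: tensor_map_add dims) (simp add: eval_nat_numeral)
    also have "\<dots> = (\<Sum>b<4. complex_of_real (c b) * bell_proj b $$ (i * 2 + k, j * 2 + l))"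
      using that by (intro sum.cong refl) (simp add: c(2))
    finally show ?thesis .
  qed
  then obtain x y where xy: "x > 0" "y > 0" "\<alpha> = complex_of_real x \<cdot>\<^sub>m 1\<^sub>m 2" "\<gamma> = complex_of_real y \<cdot>\<^sub>m 1\<^sub>m 2"
    "\<And>b. b < 4 \<Longrightarrow> c b = x * y"
    by (rule kron_eq_bell_mixture[of c \<alpha> \<gamma>, rotated])
      (auto simp: \<alpha>_def \<gamma>_def \<Lambda>1_def \<Lambda>2_def c(1) intro!: kraus_one_diag_nonneg)
  show ?thesis
  \<comment> \<open>Dividing by \<open>x\<close> and \<open>y\<close> makes the maps unital, and
    since every weight equals \<open>x * y\<close>, the same scaling removes the weights.\<close>
  proof (rule exI[of _ "\<lambda>X. complex_of_real (1 / x) \<cdot>\<^sub>m \<Lambda>1 X"],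
      rule exI[of _ "\<lambda>X. complex_of_real (1 / y) \<cdot>\<^sub>m \<Lambda>2 X"], intro conjI allI impI)
    show "completely_positive dB1 2 (\<lambda>X. complex_of_real (1 / x) \<cdot>\<^sub>m \<Lambda>1 X)"
      unfolding \<Lambda>1_def using xy(1) by (intro completely_positive_smult_kraus) simp
    show "completely_positive dB2 2 (\<lambda>X. complex_of_real (1 / y) \<cdot>\<^sub>m \<Lambda>2 X)"
      unfolding \<Lambda>2_def using xy(2) by (intro completely_positive_smult_kraus) simp
    show "unital dB1 2 (\<lambda>X. complex_of_real (1 / x) \<cdot>\<^sub>m \<Lambda>1 X)"
      unfolding unital_def \<alpha>_def[symmetric] xy(3) using xy(1) by (intro eq_matI) auto
    show "unital dB2 2 (\<lambda>X. complex_of_real (1 / y) \<cdot>\<^sub>m \<Lambda>2 X)"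
      unfolding unital_def \<gamma>_def[symmetric] xy(4) using xy(2) by (intro eq_matI) auto
    fix b :: nat assume b: "b < 4"
    have "tensor_map dB1 dB2 2 2 \<Lambda>1 \<Lambda>2 (B b) $$ (r,s) = complex_of_real (x * y) * bell_proj b $$ (r,s)"
      if "r < 4" "s < 4" for r s
    proof -
      have "r div 2 < 2" "s div 2 < 2" using that by auto
      then show ?thesis
        using c(2)[OF b, of "r div 2" "s div 2" "r mod 2" "s mod 2"] xy(5)[OF b] by simp
    qed
    then show "tensor_map dB1 dB2 2 2 (\<lambda>X. complex_of_real (1 / x) \<cdot>\<^sub>m \<Lambda>1 X) (\<lambda>X. complex_of_real (1 / y) \<cdot>\<^sub>m \<Lambda>2 X) (B b) = bell_proj b"
      using xy(1,2) by (subst tensor_map_smult)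
        (auto simp: \<Lambda>1_def \<Lambda>2_def bell_proj_def tensor_map_def intro!: eq_matI)
  qed
qed

end
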